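(* The cost functional $\mathcal{L}^\alpha$ has a critical point in $\mathscr{C}^0([a,b],\mathbb{R}^m)$ if and only if there exists $(q,u,p)\in\mathscr{C}^{[\alpha]}([a,b],\mathbb{R}^d)\times\mathscr{C}^0([a,b],\mathbb{R}^m)\times\mathscr{C}^{[\alpha]}([a,b],\mathbb{R}^d)$ solution of the fractional Pontryagin's system $$\left\lbrace\begin{array}{l} {}_{\rm c}D^\alpha_- q=\dfrac{\partial H}{\partial w}(q,u,p,t)\\[8pt] D^\alpha_+ p=\dfrac{\partial H}{\partial x}(q,u,p,t)\\[8pt] \dfrac{\partial H}{\partial v}(q,u,p,t)=0\\[8pt] \big(q(a),p(b)\big)=(A,0). \end{array}\right.$$ In the affirmative case, $u$ is a critical point of $\mathcal{L}^\alpha$ and $(q,p)=(q^{u,\alpha},p^{u,\alpha})$.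
   Context: Let $a<b$ be reals, $d,m\in\mathbb{N}^*$, $0<\alpha\le 1$, $A\in\mathbb{R}^d$; $\Vert\cdot\Vert$ is the Euclidean norm; $[\alpha]$ is the floor of $\alpha$ (so $\mathscr{C}^{[\alpha]}$ is $\mathscr{C}^0$ if $\alpha<1$ and $\mathscr{C}^1$ if $\alpha=1$). Fractional operators. For $g\in\mathscr{C}^0([a,b],\mathbb{R}^d)$ and $\beta>0$: $I^\beta_- g(t)=\frac{1}{\Gamma(\beta)}\int_a^t (t-y)^{\beta-1}g(y)\,dy$ for $t\in(a,b]$, and $I^\beta_+ g(t)=\frac{1}{\Gamma(\beta)}\int_t^b (y-t)^{\beta-1}g(y)\,dy$ for $t\in[a,b)$, extended continuously by $0$ at $a$, resp. $b$; $I^0_\pm g=g$. Riemann-Liouville derivatives: $D^\alpha_- g=\frac{d}{dt}(I^{1-\alpha}_- g)$ on $(a,b]$, $D^\alpha_+ g=-\frac{d}{dt}(I^{1-\alpha}_+ g)$ on $[a,b)$. Caputo derivatives: ${}_{\rm c}D^\alpha_- g=D^\alpha_-(g-g(a))$ on $(a,b]$, ${}_{\rm c}D^\alpha_+ g=D^\alpha_+(g-g(b))$ on $[a,b)$, whenever the right-hand sides are defined. A function defined on $(a,b]$ (resp. $[a,b)$) is regarded as an element of $\mathscr{C}^0([a,b],\mathbb{R}^d)$ if it is continuous there and extends continuously to $t=a$ (resp. $t=b$). Control problem. Elements $u\in\mathscr{C}^0([a,b],\mathbb{R}^m)$ are called controls. The constraint function $f:\mathbb{R}^d\times\mathbb{R}^m\times[a,b]\to\mathbb{R}^d$,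 $(x,v,t)\mapsto f(x,v,t)$, is $\mathscr{C}^2$ and there is $M\ge 0$ with $\Vert f(x_1,v,t)-f(x_2,v,t)\Vert\le M\Vert x_1-x_2\Vert$ for all $x_1,x_2\in\mathbb{R}^d$, $v\in\mathbb{R}^m$, $t\in[a,b]$. The Lagrangian $L:\mathbb{R}^d\times\mathbb{R}^m\times[a,b]\to\mathbb{R}$, $(x,v,t)\mapsto L(x,v,t)$, is $\mathscr{C}^2$. The Hamiltonian is $H:\mathbb{R}^d\times\mathbb{R}^m\times\mathbb{R}^d\times[a,b]\to\mathbb{R}$, $H(x,v,w,t)=L(x,v,t)+w\cdot f(x,v,t)$. For a control $u$, the state variable $q^{u,\alpha}\in\mathscr{C}^{[\alpha]}([a,b],\mathbb{R}^d)$ is the unique global solution of ${}_{\rm c}D^\alpha_- q=f(q,u,t)$, $q(a)=A$. The adjoint variable $p^{u,\alpha}\in\mathscr{C}^{[\alpha]}([a,b],\mathbb{R}^d)$ is the unique global solution of $${}_{\rm c}D^\alpha_+ p=\frac{\partial H}{\partial x}(q^{u,\alpha},u,p,t)=\frac{\partial L}{\partial x}(q^{u,\alpha},u,t)+\Big(\frac{\partial f}{\partial x}(q^{u,\alpha},u,t)\Big)^T p,\qquad p(b)=0.$$ The cost functional is $\mathcal{L}^\alpha:\mathscr{C}^0([a,b],\mathbb{R}^m)\to\mathbb{R}$, $\mathcal{L}^\alpha(u)=\int_a^b L(q^{u,\alpha},u,t)\,dt$. A control $u$ is a critical point of $\mathcal{L}^\alpha$ if for every $\bar u\in\mathscr{C}^0([a,b],\mathbb{R}^m)$,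 $D\mathcal{L}^\alpha(u)(\bar u):=\lim_{\varepsilon\to0}\frac{\mathcal{L}^\alpha(u+\varepsilon\bar u)-\mathcal{L}^\alpha(u)}{\varepsilon}=0$. *)

theory Defs
  imports "HOL-Analysis.Analysis"
begin

text \<open>Throughout, an element of a function space over \<open>[a,b]\<close> is a total function on \<open>real\<close> of which
  only the values on \<open>{a..b}\<close> are relevant.\<close>

subsection \<open>Regularity\<close>

text \<open>Derivatives are one-sided at boundary points of \<open>S\<close>.\<close>

primrec Ck_on :: "nat \<Rightarrow> real set \<Rightarrow> (real \<Rightarrow> 'a::real_normed_vector) \<Rightarrow> bool" where
  "Ck_on 0 S g \<longleftrightarrow> continuous_on S g"
| "Ck_on (Suc k) S g \<longleftrightarrow>
     (\<exists>g'. (\<forall>t\<in>S. (g has_vector_derivative g' t) (at t within S)) \<and> Ck_on k S g')"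

definition C2_on :: "'a::real_normed_vector set \<Rightarrow> ('a \<Rightarrow> 'b::real_normed_vector) \<Rightarrow> bool" where
  "C2_on S F \<longleftrightarrow>
     (\<exists>(F' :: 'a \<Rightarrow> 'a \<Rightarrow>\<^sub>L 'b) (F'' :: 'a \<Rightarrow> 'a \<Rightarrow>\<^sub>L ('a \<Rightarrow>\<^sub>L 'b)).
        (\<forall>z\<in>S. (F has_derivative blinfun_apply (F' z)) (at z within S)) \<and>
        (\<forall>z\<in>S. (F' has_derivative blinfun_apply (F'' z)) (at z within S)) \<and>
        continuous_on S F'')"

definition grad :: "('a::real_inner \<Rightarrow> real) \<Rightarrow> 'a \<Rightarrow> 'a" where
  "grad F x = (THE D. GDERIV F x :> D)"

subsection \<open>Fractional operators\<close>

text \<open>For positive \<open>\<beta>\<close> both integrals vanish at the base point (\<open>t = a\<close>, respectively \<open>t = b\<close>),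
  which is the continuous extension of the fractional integral of a continuous function.\<close>

definition frac_int_left :: "real \<Rightarrow> real \<Rightarrow> (real \<Rightarrow> 'a::euclidean_space) \<Rightarrow> real \<Rightarrow> 'a" where
  "frac_int_left a \<beta> g t =
     (if \<beta> = 0 then g t
      else (1 / Gamma \<beta>) *\<^sub>R integral {a..t} (\<lambda>y. (t - y) powr (\<beta> - 1) *\<^sub>R g y))"

definition frac_int_right :: "real \<Rightarrow> real \<Rightarrow> (real \<Rightarrow> 'a::euclidean_space) \<Rightarrow> real \<Rightarrow> 'a" where
  "frac_int_right b \<beta> g t =
     (if \<beta> = 0 then g t
      else (1 / Gamma \<beta>) *\<^sub>R integral {t..b} (\<lambda>y. (y - t) powr (\<beta> - 1) *\<^sub>R g y))"

text \<open>The derivatives are relations: ``the derivative of \<open>g\<close> at \<open>t\<close> is defined and equals \<open>D\<close>''.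
  They are meant for \<open>t \<in> {a<..b}\<close> (left) and \<open>t \<in> {a..<b}\<close> (right).\<close>

definition has_RL_deriv_left ::
    "real \<Rightarrow> real \<Rightarrow> real \<Rightarrow> (real \<Rightarrow> 'a::euclidean_space) \<Rightarrow> real \<Rightarrow> 'a \<Rightarrow> bool" where
  "has_RL_deriv_left a b \<alpha> g t D \<longleftrightarrow>
     (frac_int_left a (1 - \<alpha>) g has_vector_derivative D) (at t within {a<..b})"

definition has_RL_deriv_right ::
    "real \<Rightarrow> real \<Rightarrow> real \<Rightarrow> (real \<Rightarrow> 'a::euclidean_space) \<Rightarrow> real \<Rightarrow> 'a \<Rightarrow> bool" where
  "has_RL_deriv_right a b \<alpha> g t D \<longleftrightarrow>
     (frac_int_right b (1 - \<alpha>) g has_vector_derivative - D) (at t within {a..<b})"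

definition has_Caputo_deriv_left ::
    "real \<Rightarrow> real \<Rightarrow> real \<Rightarrow> (real \<Rightarrow> 'a::euclidean_space) \<Rightarrow> real \<Rightarrow> 'a \<Rightarrow> bool" where
  "has_Caputo_deriv_left a b \<alpha> g t D \<longleftrightarrow> has_RL_deriv_left a b \<alpha> (\<lambda>s. g s - g a) t D"

definition has_Caputo_deriv_right ::
    "real \<Rightarrow> real \<Rightarrow> real \<Rightarrow> (real \<Rightarrow> 'a::euclidean_space) \<Rightarrow> real \<Rightarrow> 'a \<Rightarrow> bool" where
  "has_Caputo_deriv_right a b \<alpha> g t D \<longleftrightarrow> has_RL_deriv_right a b \<alpha> (\<lambda>s. g s - g b) t D"

subsection \<open>Control problem\<close>

definition hamiltonian ::
    "(real^'d \<Rightarrow> real^'m \<Rightarrow> real \<Rightarrow> real) \<Rightarrow> (real^'d \<Rightarrow> real^'m \<Rightarrow> real \<Rightarrow> real^'d) \<Rightarrow>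
     real^'d \<Rightarrow> real^'m \<Rightarrow> real^'d \<Rightarrow> real \<Rightarrow> real" where
  "hamiltonian L f x v w t = L x v t + w \<bullet> f x v t"

definition dH_dx ::
    "(real^'d \<Rightarrow> real^'m \<Rightarrow> real \<Rightarrow> real) \<Rightarrow> (real^'d \<Rightarrow> real^'m \<Rightarrow> real \<Rightarrow> real^'d) \<Rightarrow>
     real^'d \<Rightarrow> real^'m \<Rightarrow> real^'d \<Rightarrow> real \<Rightarrow> real^'d" where
  "dH_dx L f x v w t = grad (\<lambda>\<xi>. hamiltonian L f \<xi> v w t) x"

definition dH_dv ::
    "(real^'d \<Rightarrow> real^'m \<Rightarrow> real \<Rightarrow> real) \<Rightarrow> (real^'d \<Rightarrow> real^'m \<Rightarrow> real \<Rightarrow> real^'d) \<Rightarrow>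
     real^'d \<Rightarrow> real^'m \<Rightarrow> real^'d \<Rightarrow> real \<Rightarrow> real^'m" where
  "dH_dv L f x v w t = grad (\<lambda>\<nu>. hamiltonian L f x \<nu> w t) v"

definition dH_dw ::
    "(real^'d \<Rightarrow> real^'m \<Rightarrow> real \<Rightarrow> real) \<Rightarrow> (real^'d \<Rightarrow> real^'m \<Rightarrow> real \<Rightarrow> real^'d) \<Rightarrow>
     real^'d \<Rightarrow> real^'m \<Rightarrow> real^'d \<Rightarrow> real \<Rightarrow> real^'d" where
  "dH_dw L f x v w t = grad (\<lambda>\<omega>. hamiltonian L f x v \<omega> t) w"

text \<open>The fractional equations are imposed on the half-open interval where the derivative is defined.
  Their right-hand sides are continuous on \<open>{a..b}\<close>, so the derivatives then extend continuously to
  the missing endpoint with the value prescribed by the equation.\<close>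

definition is_state ::
    "real \<Rightarrow> real \<Rightarrow> real \<Rightarrow> real^'d \<Rightarrow> (real^'d \<Rightarrow> real^'m \<Rightarrow> real \<Rightarrow> real^'d) \<Rightarrow>
     (real \<Rightarrow> real^'m) \<Rightarrow> (real \<Rightarrow> real^'d) \<Rightarrow> bool" where
  "is_state a b \<alpha> A f u q \<longleftrightarrow>
     Ck_on (nat \<lfloor>\<alpha>\<rfloor>) {a..b} q \<and>
     (\<forall>t\<in>{a<..b}. has_Caputo_deriv_left a b \<alpha> q t (f (q t) (u t) t)) \<and>
     q a = A"

text \<open>Solutions are unique as functions on \<open>{a..b}\<close>; \<open>extensional\<close> fixes the irrelevant values outside.\<close>

definition state ::
    "real \<Rightarrow> real \<Rightarrow> real \<Rightarrow> real^'d \<Rightarrow> (real^'d \<Rightarrow> real^'m \<Rightarrow> real \<Rightarrow> real^'d) \<Rightarrow>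
     (real \<Rightarrow> real^'m) \<Rightarrow> real \<Rightarrow> real^'d" where
  "state a b \<alpha> A f u = (THE q. q \<in> extensional {a..b} \<and> is_state a b \<alpha> A f u q)"

definition is_adjoint ::
    "real \<Rightarrow> real \<Rightarrow> real \<Rightarrow> real^'d \<Rightarrow> (real^'d \<Rightarrow> real^'m \<Rightarrow> real \<Rightarrow> real) \<Rightarrow>
     (real^'d \<Rightarrow> real^'m \<Rightarrow> real \<Rightarrow> real^'d) \<Rightarrow> (real \<Rightarrow> real^'m) \<Rightarrow> (real \<Rightarrow> real^'d) \<Rightarrow> bool" where
  "is_adjoint a b \<alpha> A L f u p \<longleftrightarrow>
     Ck_on (nat \<lfloor>\<alpha>\<rfloor>) {a..b} p \<and>
     (\<forall>t\<in>{a..<b}. has_Caputo_deriv_right a b \<alpha> p t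
        (dH_dx L f (state a b \<alpha> A f u t) (u t) (p t) t)) \<and>
     p b = 0"

definition adjoint_var ::
    "real \<Rightarrow> real \<Rightarrow> real \<Rightarrow> real^'d \<Rightarrow> (real^'d \<Rightarrow> real^'m \<Rightarrow> real \<Rightarrow> real) \<Rightarrow>
     (real^'d \<Rightarrow> real^'m \<Rightarrow> real \<Rightarrow> real^'d) \<Rightarrow> (real \<Rightarrow> real^'m) \<Rightarrow> real \<Rightarrow> real^'d" where
  "adjoint_var a b \<alpha> A L f u = (THE p. p \<in> extensional {a..b} \<and> is_adjoint a b \<alpha> A L f u p)"

definition cost ::
    "real \<Rightarrow> real \<Rightarrow> real \<Rightarrow> real^'d \<Rightarrow> (real^'d \<Rightarrow> real^'m \<Rightarrow> real \<Rightarrow> real) \<Rightarrow>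
     (real^'d \<Rightarrow> real^'m \<Rightarrow> real \<Rightarrow> real^'d) \<Rightarrow> (real \<Rightarrow> real^'m) \<Rightarrow> real" where
  "cost a b \<alpha> A L f u = integral {a..b} (\<lambda>t. L (state a b \<alpha> A f u t) (u t) t)"

definition critical_point ::
    "real \<Rightarrow> real \<Rightarrow> real \<Rightarrow> real^'d \<Rightarrow> (real^'d \<Rightarrow> real^'m \<Rightarrow> real \<Rightarrow> real) \<Rightarrow>
     (real^'d \<Rightarrow> real^'m \<Rightarrow> real \<Rightarrow> real^'d) \<Rightarrow> (real \<Rightarrow> real^'m) \<Rightarrow> bool" where
  "critical_point a b \<alpha> A L f u \<longleftrightarrow>
     continuous_on {a..b} u \<and>
     (\<forall>h. continuous_on {a..b} h \<longrightarrow>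
        ((\<lambda>\<epsilon>. (cost a b \<alpha> A L f (\<lambda>t. u t + \<epsilon> *\<^sub>R h t) - cost a b \<alpha> A L f u) / \<epsilon>) \<longlongrightarrow> 0) (at 0))"

definition pontryagin_solution ::
    "real \<Rightarrow> real \<Rightarrow> real \<Rightarrow> real^'d \<Rightarrow> (real^'d \<Rightarrow> real^'m \<Rightarrow> real \<Rightarrow> real) \<Rightarrow>
     (real^'d \<Rightarrow> real^'m \<Rightarrow> real \<Rightarrow> real^'d) \<Rightarrow>
     (real \<Rightarrow> real^'d) \<Rightarrow> (real \<Rightarrow> real^'m) \<Rightarrow> (real \<Rightarrow> real^'d) \<Rightarrow> bool" where
  "pontryagin_solution a b \<alpha> A L f q u p \<longleftrightarrow>
     Ck_on (nat \<lfloor>\<alpha>\<rfloor>) {a..b} q \<and> continuous_on {a..b} u \<and> Ck_on (nat \<lfloor>\<alpha>\<rfloor>) {a..b} p \<and>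
     (\<forall>t\<in>{a<..b}. has_Caputo_deriv_left a b \<alpha> q t (dH_dw L f (q t) (u t) (p t) t)) \<and>
     (\<forall>t\<in>{a..<b}. has_RL_deriv_right a b \<alpha> p t (dH_dx L f (q t) (u t) (p t) t)) \<and>
     (\<forall>t\<in>{a..b}. dH_dv L f (q t) (u t) (p t) t = 0) \<and>
     q a = A \<and> p b = 0"

end

theory Submission
  imports Defs
begin

text \<open>A perturbation \<open>u + \<epsilon> h\<close> of a control moves the state by \<open>\<delta> = O(\<epsilon>)\<close>,
  and \<open>\<delta>\<close> is the left fractional integral of the increment \<open>r\<close> of \<open>f\<close> along the two trajectories.
  Expanding \<open>L\<close> to first order leaves the term \<open>\<integral> \<partial>L/\<partial>x \<bullet> \<delta>\<close>, which involves the unknown \<open>\<delta>\<close>. The adjoint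
  variable removes it: \<open>p\<close> is the right fractional integral of \<open>\<partial>H/\<partial>x\<close>, so fractional integration by parts
  gives \<open>\<integral> \<partial>H/\<partial>x \<bullet> \<delta> = \<integral> p \<bullet> r\<close>, and expanding \<open>r\<close> on the right cancels every term containing \<open>\<delta>\<close>.
  What remains is \<open>\<epsilon> \<integral> \<partial>H/\<partial>v \<bullet> h + o(\<epsilon>)\<close>. Hence the directional derivative of the cost at \<open>u\<close> along \<open>h\<close>
  is \<open>\<integral> \<partial>H/\<partial>v \<bullet> h\<close>, and taking \<open>h = \<partial>H/\<partial>v\<close> shows that \<open>u\<close> is critical exactly when \<open>\<partial>H/\<partial>v\<close> vanishes
  along \<open>(q, u, p)\<close>. This is \<open>cost_derivative\<close> and \<open>critical_point_iff\<close>. The increment \<open>\<delta>\<close> itself is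
  expanded, rather than a linearized state, so that differentiability of the state in \<open>\<epsilon>\<close> never
  has to be established; an \<open>O(\<epsilon>)\<close> bound on \<open>\<delta>\<close> (\<open>state_perturbation\<close>) is enough.

  The two fractional equations are handled as Volterra integral equations
  (\<open>caputo_left_iff_volterra\<close>, \<open>caputo_right_iff_volterra\<close>). The passage rests on the composition law
  \<open>I\<^bsup>1-\<alpha>\<^esup> I\<^bsup>\<alpha>\<^esup> = I\<^bsup>1\<^esup>\<close>, which, like integration by parts, is Fubini's theorem on a triangle with the weakly singular
  kernel (\<open>fubini_triangle_kernel\<close>). Existence, uniqueness and the \<open>O(\<epsilon>)\<close> bound all come from one
  estimate: with respect to an exponential weight \<open>exp (c t)\<close> the operator \<open>I\<^bsup>\<alpha>\<^esup>\<close> has norm at most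
  \<open>c\<^bsup>-\<alpha>\<^esup>\<close> (\<open>norm_frac_int_left_exp_le\<close>), which is as small as desired. The Volterra theory of
  right-sided integrals follows from that of the left-sided ones by the reflection \<open>t \<mapsto> - t\<close>.

  With this, Pontryagin's system for \<open>(q, u, p)\<close> says that \<open>q\<close> and \<open>p\<close> are the state and adjoint variable
  of \<open>u\<close> and that \<open>\<partial>H/\<partial>v\<close> vanishes, that is, that \<open>u\<close> is critical. The condition \<open>p b = 0\<close> makes the
  Riemann-Liouville and Caputo right derivatives of \<open>p\<close> coincide.\<close>

section \<open>Fractional integrals of continuous functions\<close>

lemma kernel_has_integral:
  fixes a t \<beta> :: real
  assumes "0 < \<beta>" and "a \<le> t"
  shows "((\<lambda>y. (t - y) powr (\<beta> - 1)) has_integral (t - a) powr \<beta> / \<beta>) {a..t}"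
proof -
  have "((\<lambda>x. x powr (\<beta> - 1)) has_integral (t - a) powr (\<beta> - 1 + 1) / (\<beta> - 1 + 1)) (cbox 0 (t - a))"
    using has_integral_powr_from_0[of "\<beta> - 1" "t - a"] assms by simp
  from has_integral_affinity[OF this, of "-1" t] show ?thesis
    using assms by (simp add: image_affinity_atLeastAtMost_diff image_affinity_atLeastAtMost algebra_simps)
qed

lemma kernel_abs_integrable:
  fixes a t \<beta> :: real
  assumes "0 < \<beta>"
  shows "(\<lambda>y. (t - y) powr (\<beta> - 1)) absolutely_integrable_on {a..t}"
proof (cases "a \<le> t")
  case True
  then show ?thesis
    using kernel_has_integral[OF assms True]
    by (intro nonnegative_absolutely_integrable_1) auto
next
  case False
  then show ?thesis by (simp add: absolutely_integrable_on_def)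
qed

lemma kernel_scaleR_abs_integrable:
  fixes g :: "real \<Rightarrow> 'a::euclidean_space"
  assumes "0 < \<beta>" and "continuous_on {a..t} g"
  shows "(\<lambda>y. (t - y) powr (\<beta> - 1) *\<^sub>R g y) absolutely_integrable_on {a..t}"
proof -
  have "(\<lambda>y. (t - y) powr (\<beta> - 1) *\<^sub>R g y) absolutely_integrable_on {a..t}"
  proof (rule absolutely_integrable_bounded_measurable_product[where h = "\<lambda>v c. c *\<^sub>R v" and f = g])
    show "bilinear (\<lambda>v c. c *\<^sub>R v :: 'a)"
      by (auto simp: bilinear_def linear_iff algebra_simps)
    show "bounded (g ` {a..t})"
      by (intro compact_imp_bounded compact_continuous_image assms) auto
    show "g \<in> borel_measurable (lebesgue_on {a..t})"
      by (rule continuous_imp_measurable_on_sets_lebesgue[OF assms(2)]) auto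
    show "(\<lambda>y. (t - y) powr (\<beta> - 1)) absolutely_integrable_on {a..t}"
      by (rule kernel_abs_integrable[OF assms(1)])
  qed auto
  then show ?thesis .
qed

lemma frac_int_left_has_integral:
  fixes g :: "real \<Rightarrow> 'a::euclidean_space"
  assumes "0 < \<beta>" and "continuous_on {a..t} g"
  shows "((\<lambda>y. (t - y) powr (\<beta> - 1) *\<^sub>R g y) has_integral Gamma \<beta> *\<^sub>R frac_int_left a \<beta> g t) {a..t}"
proof -
  have "Gamma \<beta> > 0" using assms by (simp add: Gamma_real_pos)
  then show ?thesis
    using set_lebesgue_integral_eq_integral(1)[OF kernel_scaleR_abs_integrable[OF assms]] assms(1)
    by (simp add: frac_int_left_def has_integral_integral less_imp_neq[symmetric])
qed

lemma frac_int_left_cong: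
  assumes "\<And>y. y \<in> {a..t} \<Longrightarrow> g y = h y" and "a \<le> t"
  shows "frac_int_left a \<beta> g t = frac_int_left a \<beta> h t"
  using assms by (auto simp: frac_int_left_def intro!: integral_cong)

lemma frac_int_left_base:
  "0 < \<beta> \<Longrightarrow> frac_int_left a \<beta> g a = 0"
  by (simp add: frac_int_left_def)

lemma frac_int_left_one:
  assumes "continuous_on {a..t} g"
  shows "frac_int_left a 1 g t = integral {a..t} g"
proof -
  have "integral {a..t} (\<lambda>y. (t - y) powr (1 - 1) *\<^sub>R g y) = integral {a..t} g"
    by (rule integral_spike[of "{t}"]) auto
  then show ?thesis by (simp add: frac_int_left_def)
qed

lemma frac_int_left_diff:
  fixes g h :: "real \<Rightarrow> 'a::euclidean_space"
  assumes "0 < \<beta>" and "continuous_on {a..t} g" and "continuous_on {a..t} h"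
  shows "frac_int_left a \<beta> (\<lambda>y. g y - h y) t = frac_int_left a \<beta> g t - frac_int_left a \<beta> h t"
proof -
  have "Gamma \<beta> > 0" using assms by (simp add: Gamma_real_pos)
  have "((\<lambda>y. (t - y) powr (\<beta> - 1) *\<^sub>R g y - (t - y) powr (\<beta> - 1) *\<^sub>R h y) has_integral
     Gamma \<beta> *\<^sub>R frac_int_left a \<beta> g t - Gamma \<beta> *\<^sub>R frac_int_left a \<beta> h t) {a..t}"
    by (intro has_integral_diff frac_int_left_has_integral assms)
  moreover have "((\<lambda>y. (t - y) powr (\<beta> - 1) *\<^sub>R (g y - h y)) has_integral
     Gamma \<beta> *\<^sub>R frac_int_left a \<beta> (\<lambda>y. g y - h y) t) {a..t}"
    by (intro frac_int_left_has_integral continuous_intros assms)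
  ultimately have "Gamma \<beta> *\<^sub>R frac_int_left a \<beta> (\<lambda>y. g y - h y) t
      = Gamma \<beta> *\<^sub>R (frac_int_left a \<beta> g t - frac_int_left a \<beta> h t)"
    by (metis (no_types, lifting) has_integral_unique scaleR_right_diff_distrib has_integral_cong)
  then show ?thesis using \<open>Gamma \<beta> > 0\<close> by simp
qed

text \<open>The substitution \<open>y = a + (t - a) \<sigma>\<close> fixes both the interval of integration and the place of the
  singularity, so that \<open>t\<close> enters only through the continuous function \<open>g\<close> and the prefactor. This is what makes
  dominated convergence applicable in \<open>continuous_on_frac_int_left\<close>.\<close>

lemma frac_int_left_scaled:
  fixes g :: "real \<Rightarrow> 'a::euclidean_space"
  assumes "0 < \<beta>" and "a \<le> t" and "continuous_on {a..t} g"
  shows "frac_int_left a \<beta> g t =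
    ((t - a) powr \<beta> / Gamma \<beta>) *\<^sub>R integral {0..1} (\<lambda>\<sigma>. (1 - \<sigma>) powr (\<beta> - 1) *\<^sub>R g (a + (t - a) * \<sigma>))"
proof (cases "a = t")
  case False
  then have at: "a < t" using assms by simp
  have G: "Gamma \<beta> > 0" using assms by (simp add: Gamma_real_pos)
  have "((\<lambda>y. (t - y) powr (\<beta> - 1) *\<^sub>R g y) has_integral Gamma \<beta> *\<^sub>R frac_int_left a \<beta> g t) (cbox a t)"
    using frac_int_left_has_integral[OF assms(1,3)] by simp
  from has_integral_affinity[OF this, of "t - a" a]
  have "((\<lambda>\<sigma>. (t - ((t - a) * \<sigma> + a)) powr (\<beta> - 1) *\<^sub>R g ((t - a) * \<sigma> + a)) has_integral
      (1 / (t - a)) *\<^sub>R Gamma \<beta> *\<^sub>R frac_int_left a \<beta> g t)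
      ((\<lambda>x. (1 / (t - a)) *\<^sub>R x + - ((1 / (t - a)) *\<^sub>R a)) ` cbox a t)"
    using at by simp
  moreover have "((\<lambda>x. (1 / (t - a)) *\<^sub>R x + - ((1 / (t - a)) *\<^sub>R a)) ` cbox a t) = {0..1}"
  proof -
    have "(\<lambda>x. (1 / (t - a)) *\<^sub>R x + - ((1 / (t - a)) *\<^sub>R a)) = (\<lambda>x. (1 / (t - a)) * x + (- (a / (t - a))))"
      by auto
    then show ?thesis using at
      by (simp only: interval_cbox[symmetric] image_affinity_atLeastAtMost) (auto simp: divide_simps)
  qed
  ultimately have 1: "((\<lambda>\<sigma>. (t - ((t - a) * \<sigma> + a)) powr (\<beta> - 1) *\<^sub>R g ((t - a) * \<sigma> + a)) has_integral
      (Gamma \<beta> / (t - a)) *\<^sub>R frac_int_left a \<beta> g t) {0..1}"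
    by simp
  have e: "(t - ((t - a) * \<sigma> + a)) powr (\<beta> - 1) *\<^sub>R g ((t - a) * \<sigma> + a)
    = (t - a) powr (\<beta> - 1) *\<^sub>R (1 - \<sigma>) powr (\<beta> - 1) *\<^sub>R g (a + (t - a) * \<sigma>)"
    if "\<sigma> \<in> {0..1}" for \<sigma>
  proof -
    have "t - ((t - a) * \<sigma> + a) = (t - a) * (1 - \<sigma>)" by (simp add: algebra_simps)
    then show ?thesis using at that by (simp add: powr_mult add.commute)
  qed
  have "(Gamma \<beta> / (t - a)) *\<^sub>R frac_int_left a \<beta> g t
     = integral {0..1} (\<lambda>\<sigma>. (t - a) powr (\<beta> - 1) *\<^sub>R (1 - \<sigma>) powr (\<beta> - 1) *\<^sub>R g (a + (t - a) * \<sigma>))"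
    by (subst integral_unique[OF 1, symmetric]) (rule integral_cong[OF e])
  then have "(Gamma \<beta> / (t - a)) *\<^sub>R frac_int_left a \<beta> g t
     = (t - a) powr (\<beta> - 1) *\<^sub>R integral {0..1} (\<lambda>\<sigma>. (1 - \<sigma>) powr (\<beta> - 1) *\<^sub>R g (a + (t - a) * \<sigma>))"
    by (simp only: integral_cmul)
  then have "((t - a) / Gamma \<beta>) *\<^sub>R (Gamma \<beta> / (t - a)) *\<^sub>R frac_int_left a \<beta> g t
     = ((t - a) / Gamma \<beta>) *\<^sub>R (t - a) powr (\<beta> - 1) *\<^sub>R integral {0..1} (\<lambda>\<sigma>. (1 - \<sigma>) powr (\<beta> - 1) *\<^sub>R g (a + (t - a) * \<sigma>))"
    by simp
  then show ?thesis using at G by (simp add: powr_diff)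
qed (use assms in \<open>simp add: frac_int_left_base\<close>)

lemma continuous_on_frac_int_left:
  fixes g :: "real \<Rightarrow> 'a::euclidean_space"
  assumes "0 < \<beta>" and g: "continuous_on {a..b} g"
  shows "continuous_on {a..b} (frac_int_left a \<beta> g)"
proof -
  define J where "J t = integral {0..1} (\<lambda>\<sigma>. (1 - \<sigma>) powr (\<beta> - 1) *\<^sub>R g (a + (t - a) * \<sigma>))" for t
  have in_ab: "a + (t - a) * \<sigma> \<in> {a..b}" if "t \<in> {a..b}" "\<sigma> \<in> {0..1}" for t \<sigma>
  proof -
    have "(t - a) * \<sigma> \<le> (t - a) * 1" "0 \<le> (t - a) * \<sigma>"
      using that by (auto intro!: mult_left_mono simp del: mult_1_right)
    then show ?thesis using that by auto
  qed
  have "bounded (g ` {a..b})"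
    by (intro compact_imp_bounded compact_continuous_image g) auto
  then obtain C where C: "\<And>y. y \<in> {a..b} \<Longrightarrow> norm (g y) \<le> C"
    unfolding bounded_iff by blast
  have "continuous_on {a..b} J"
    unfolding continuous_on_sequentially
  proof (intro allI impI ballI, elim conjE)
    fix x t assume t: "t \<in> {a..b}" "\<forall>n. x n \<in> {a..b}" "x \<longlonglongrightarrow> t"
    have "(\<lambda>n. integral {0..1} (\<lambda>\<sigma>. (1 - \<sigma>) powr (\<beta> - 1) *\<^sub>R g (a + (x n - a) * \<sigma>)))
       \<longlonglongrightarrow> integral {0..1} (\<lambda>\<sigma>. (1 - \<sigma>) powr (\<beta> - 1) *\<^sub>R g (a + (t - a) * \<sigma>))"
    proof (rule dominated_convergence(2))
      show "(\<lambda>\<sigma>. (1 - \<sigma>) powr (\<beta> - 1) *\<^sub>R g (a + (x n - a) * \<sigma>)) integrable_on {0..1}" for n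
      proof (rule set_lebesgue_integral_eq_integral(1)[OF kernel_scaleR_abs_integrable[OF assms(1)]])
        show "continuous_on {0..1} (\<lambda>\<sigma>. g (a + (x n - a) * \<sigma>))"
          by (rule continuous_on_compose2[OF g]) (use in_ab t in \<open>auto intro!: continuous_intros\<close>)
      qed
      show "(\<lambda>\<sigma>. C * (1 - \<sigma>) powr (\<beta> - 1)) integrable_on {0..1}"
        using kernel_has_integral[OF assms(1), of 0 1] by (intro integrable_on_mult_right) auto
      show "norm ((1 - \<sigma>) powr (\<beta> - 1) *\<^sub>R g (a + (x n - a) * \<sigma>)) \<le> C * (1 - \<sigma>) powr (\<beta> - 1)"
        if "\<sigma> \<in> {0..1}" for n \<sigma>
        using C[OF in_ab[OF _ that, of "x n"]] t by (simp add: mult.commute[of C] mult_left_mono)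
      show "(\<lambda>n. (1 - \<sigma>) powr (\<beta> - 1) *\<^sub>R g (a + (x n - a) * \<sigma>))
          \<longlonglongrightarrow> (1 - \<sigma>) powr (\<beta> - 1) *\<^sub>R g (a + (t - a) * \<sigma>)" if "\<sigma> \<in> {0..1}" for \<sigma>
      proof (intro tendsto_scaleR tendsto_const continuous_on_tendsto_compose[OF g])
        show "(\<lambda>n. a + (x n - a) * \<sigma>) \<longlonglongrightarrow> a + (t - a) * \<sigma>"
          by (intro tendsto_intros t)
      qed (use in_ab that t in auto)
    qed
    then show "(J \<circ> x) \<longlonglongrightarrow> J t" by (simp add: J_def o_def)
  qed
  moreover have "continuous_on {a..b} (\<lambda>t. (t - a) powr \<beta>)"
    by (rule continuous_on_powr') (use assms(1) in \<open>auto intro!: continuous_intros\<close>)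
  moreover have "Gamma \<beta> \<noteq> 0" using Gamma_real_pos[OF assms(1)] by simp
  ultimately have cont: "continuous_on {a..b} (\<lambda>t. ((t - a) powr \<beta> / Gamma \<beta>) *\<^sub>R J t)"
    by (intro continuous_on_scaleR continuous_on_divide continuous_on_const) auto
  have "frac_int_left a \<beta> g t = ((t - a) powr \<beta> / Gamma \<beta>) *\<^sub>R J t" if "t \<in> {a..b}" for t
    unfolding J_def
    by (rule frac_int_left_scaled) (use assms that in \<open>auto intro: continuous_on_subset\<close>)
  then show ?thesis by (intro continuous_on_eq[OF cont]) simp
qed

text \<open>The kernel integrated against \<open>exp (c y)\<close> becomes, after \<open>s = c (t - y)\<close>, a truncated Gamma integral;
  the Gamma function cancels against the normalization and leaves the factor \<open>c\<^bsup>-\<beta>\<^esup>\<close>, which tends to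
  \<open>0\<close> as \<open>c\<close> grows. A Lipschitz constant in the integrand can thus always be absorbed.\<close>

lemma norm_frac_int_left_exp_le:
  fixes g :: "real \<Rightarrow> 'a::euclidean_space"
  assumes "0 < \<beta>" and "0 < c" and "0 \<le> C" and g: "continuous_on {a..t} g"
    and le: "\<And>y. y \<in> {a..t} \<Longrightarrow> norm (g y) \<le> C * exp (c * y)" and at: "a \<le> t"
  shows "norm (frac_int_left a \<beta> g t) \<le> C * c powr (- \<beta>) * exp (c * t)"
proof -
  have G: "Gamma \<beta> > 0" using assms by (simp add: Gamma_real_pos)
  define I where "I = integral {0..c * (t - a)} (\<lambda>s. s powr (\<beta> - 1) / exp s)"
  have int: "(\<lambda>s. s powr (\<beta> - 1) / exp s) integrable_on {0..}"
    using Gamma_integral_real[OF assms(1)] by blast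
  have int': "(\<lambda>s. s powr (\<beta> - 1) / exp s) integrable_on {0..c * (t - a)}"
    by (rule integrable_on_subinterval[OF int]) auto
  have "I \<le> Gamma \<beta>"
    unfolding I_def integral_unique[OF Gamma_integral_real[OF assms(1)], symmetric]
    by (rule integral_subset_le) (use int int' in auto)
  have "((\<lambda>s. s powr (\<beta> - 1) / exp s) has_integral I) (cbox 0 (c * (t - a)))"
    using int' by (simp add: I_def has_integral_integral)
  from has_integral_affinity[OF this, of "- c" "c * t"]
  have "((\<lambda>y. (c * t - c * y) powr (\<beta> - 1) / exp (c * t - c * y)) has_integral (I / c))
     ((\<lambda>x. (1 / (- c)) *\<^sub>R x + - ((1 / (- c)) *\<^sub>R (c * t))) ` cbox 0 (c * (t - a)))"
    using assms(2) by simp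
  moreover have "((\<lambda>x. (1 / (- c)) *\<^sub>R x + - ((1 / (- c)) *\<^sub>R (c * t))) ` cbox 0 (c * (t - a))) = {a..t}"
  proof -
    have "(\<lambda>x. (1 / (- c)) *\<^sub>R x + - ((1 / (- c)) *\<^sub>R (c * t))) = (\<lambda>x. (- 1 / c) * x + t)"
      using assms(2) by auto
    then show ?thesis using at assms(2)
      by (simp only: interval_cbox[symmetric] image_affinity_atLeastAtMost) (auto simp: divide_simps)
  qed
  ultimately have "((\<lambda>y. (c * t - c * y) powr (\<beta> - 1) / exp (c * t - c * y)) has_integral (I / c)) {a..t}"
    by simp
  then have "((\<lambda>y. (C * exp (c * t) * c powr (1 - \<beta>)) * ((c * t - c * y) powr (\<beta> - 1) / exp (c * t - c * y)))
      has_integral (C * exp (c * t) * c powr (1 - \<beta>)) * (I / c)) {a..t}"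
    by (rule has_integral_mult_right)
  moreover have "(C * exp (c * t) * c powr (1 - \<beta>)) * ((c * t - c * y) powr (\<beta> - 1) / exp (c * t - c * y))
      = (t - y) powr (\<beta> - 1) * (C * exp (c * y))" if "y \<in> {a..t}" for y
  proof -
    have "(c * t - c * y) powr (\<beta> - 1) = c powr (\<beta> - 1) * (t - y) powr (\<beta> - 1)"
      using assms(2) that by (simp add: powr_mult flip: right_diff_distrib)
    moreover have "c powr (1 - \<beta>) * c powr (\<beta> - 1) = 1"
      using assms(2) by (simp flip: powr_add)
    moreover have "exp (c * t) = exp (c * t - c * y) * exp (c * y)"
      by (simp flip: exp_add)
    ultimately show ?thesis by (simp add: field_simps)
  qed
  ultimately have K: "((\<lambda>y. (t - y) powr (\<beta> - 1) * (C * exp (c * y)))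
      has_integral (C * exp (c * t) * c powr (1 - \<beta>)) * (I / c)) {a..t}"
    by (rule has_integral_eq[rotated])
  have "norm (Gamma \<beta> *\<^sub>R frac_int_left a \<beta> g t) \<le> (C * exp (c * t) * c powr (1 - \<beta>)) * (I / c)"
    unfolding integral_unique[OF K, symmetric]
      integral_unique[OF frac_int_left_has_integral[OF assms(1) g], symmetric]
  proof (rule integral_norm_bound_integral)
    show "norm ((t - y) powr (\<beta> - 1) *\<^sub>R g y) \<le> (t - y) powr (\<beta> - 1) * (C * exp (c * y))"
      if "y \<in> {a..t}" for y
      using le[OF that] by (simp add: mult_left_mono)
  qed (use K frac_int_left_has_integral[OF assms(1) g] in auto)
  also have "\<dots> = (C * exp (c * t)) * c powr (- \<beta>) * I"
    using assms(2) by (simp add: powr_diff powr_minus field_simps)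
  also have "\<dots> \<le> (C * exp (c * t)) * c powr (- \<beta>) * Gamma \<beta>"
    using \<open>I \<le> Gamma \<beta>\<close> assms(3) by (intro mult_left_mono) auto
  finally show ?thesis using G by (simp add: field_simps)
qed

section \<open>Fubini's theorem for the weakly singular kernel\<close>

lemma set_integrable_lborelI:
  fixes f :: "'a::euclidean_space \<Rightarrow> 'b::euclidean_space"
  assumes "f absolutely_integrable_on S" and "(\<lambda>x. indicator S x *\<^sub>R f x) \<in> borel_measurable borel"
  shows "set_integrable lborel S f"
  using assms unfolding set_integrable_def by (subst (asm) integrable_completion) auto

text \<open>Both sides integrate \<open>(s - y)\<^bsup>\<beta>-1\<^esup> \<sqdot> prod (G s) (g y)\<close> over the triangle \<open>a \<le> y \<le> s \<le> t\<close>. The function is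
  absolutely integrable there because \<open>g\<close> is bounded, the kernel has a bounded integral in \<open>y\<close>, and \<open>G\<close> is
  integrable. The product is an arbitrary bounded bilinear map, and \<open>G\<close> may be unbounded: integration by
  parts uses the inner product with a continuous \<open>G\<close>, whereas the composition law uses scalar multiplication
  with \<open>G s = (t - s)\<^bsup>-\<beta>\<^esup>\<close>.\<close>

lemma fubini_triangle_kernel:
  fixes prod :: "'a::euclidean_space \<Rightarrow> 'b::euclidean_space \<Rightarrow> 'c::euclidean_space"
  assumes prod: "bounded_bilinear prod" and \<beta>: "0 < \<beta>" and g: "continuous_on {a..t} g"
    and G_meas: "(\<lambda>s. indicator {a..t} s *\<^sub>R G s) \<in> borel_measurable borel"
    and G_int: "G absolutely_integrable_on {a..t}"
    and kG_int: "\<And>y. y \<in> {a..<t} \<Longrightarrow> (\<lambda>s. (s - y) powr (\<beta> - 1) *\<^sub>R G s) absolutely_integrable_on {y..t}"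
  shows "integral {a..t} (\<lambda>s. prod (G s) (integral {a..s} (\<lambda>y. (s - y) powr (\<beta> - 1) *\<^sub>R g y)))
       = integral {a..t} (\<lambda>y. prod (integral {y..t} (\<lambda>s. (s - y) powr (\<beta> - 1) *\<^sub>R G s)) (g y))"
proof -
  interpret prod: bounded_bilinear prod by (rule prod)
  define G' where "G' s = indicator {a..t} s *\<^sub>R G s" for s
  define g' where "g' y = indicator {a..t} y *\<^sub>R g y" for y
  define F where "F = (\<lambda>(s, y). if a \<le> y \<and> y \<le> s \<and> s \<le> t
       then (s - y) powr (\<beta> - 1) *\<^sub>R prod (G' s) (g' y) else 0)"
  have [measurable]: "G' \<in> borel_measurable borel"
    using G_meas by (simp add: G'_def[abs_def])
  have [measurable]: "g' \<in> borel_measurable borel"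
    unfolding g'_def[abs_def] by (rule borel_measurable_continuous_on_indicator[OF _ g]) auto
  have prod_cont: "continuous_on UNIV (\<lambda>x. prod (fst x) (snd x))"
    by (intro prod.continuous_on continuous_intros)
  have [measurable]: "(\<lambda>x. prod (G' (fst x)) (g' (snd x))) \<in> borel_measurable (borel \<Otimes>\<^sub>M borel)"
    by (rule borel_measurable_continuous_Pair[OF _ _ prod_cont]) measurable
  have F_meas[measurable]: "F \<in> borel_measurable (lborel \<Otimes>\<^sub>M lborel)"
    unfolding F_def case_prod_beta' by measurable
  have Fs: "F (s, y) = indicator {a..s} y *\<^sub>R prod (G s) ((s - y) powr (\<beta> - 1) *\<^sub>R g y)"
    if "s \<in> {a..t}" for s y
    using that by (auto simp: F_def G'_def g'_def prod.scaleR_right indicator_def)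
  have Fs0: "F (s, y) = 0" if "s \<notin> {a..t}" for s y
    using that by (auto simp: F_def)
  have Fy: "F (s, y) = indicator {y..t} s *\<^sub>R prod ((s - y) powr (\<beta> - 1) *\<^sub>R G s) (g y)"
    if "y \<in> {a..t}" for s y
    using that by (auto simp: F_def G'_def g'_def prod.scaleR_left indicator_def)
  have Fy0: "F (s, y) = 0" if "y \<notin> {a..t}" for s y
    using that by (auto simp: F_def)
  have kg_int: "(\<lambda>y. (s - y) powr (\<beta> - 1) *\<^sub>R g y) absolutely_integrable_on {a..s}" if "s \<in> {a..t}" for s
    by (rule kernel_scaleR_abs_integrable[OF \<beta>]) (use g that in \<open>auto intro: continuous_on_subset\<close>)
  have sec_s: "set_integrable lborel {a..s} (\<lambda>y. prod (G s) ((s - y) powr (\<beta> - 1) *\<^sub>R g y))"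
    if s: "s \<in> {a..t}" for s
  proof (rule set_integrable_lborelI)
    show "(\<lambda>y. prod (G s) ((s - y) powr (\<beta> - 1) *\<^sub>R g y)) absolutely_integrable_on {a..s}"
      using absolutely_integrable_linear[OF kg_int[OF s] prod.bounded_linear_right[of "G s"]]
      by (simp add: o_def)
    have "(\<lambda>y. F (s, y)) \<in> borel_measurable borel"
      using measurable_compose[OF measurable_Pair1' F_meas, of s] by simp
    then show "(\<lambda>y. indicator {a..s} y *\<^sub>R prod (G s) ((s - y) powr (\<beta> - 1) *\<^sub>R g y)) \<in> borel_measurable borel"
      by (simp add: Fs[OF s])
  qed
  have sec_y: "set_integrable lborel {y..t} (\<lambda>s. prod ((s - y) powr (\<beta> - 1) *\<^sub>R G s) (g y))"
    if y: "y \<in> {a..<t}" for y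
  proof (rule set_integrable_lborelI)
    show "(\<lambda>s. prod ((s - y) powr (\<beta> - 1) *\<^sub>R G s) (g y)) absolutely_integrable_on {y..t}"
      using absolutely_integrable_linear[OF kG_int[OF y] prod.bounded_linear_left[of "g y"]]
      by (simp add: o_def)
    have "(\<lambda>s. F (s, y)) \<in> borel_measurable borel"
      using measurable_compose[OF measurable_Pair2' F_meas, of y] by simp
    moreover have "y \<in> {a..t}" using y by auto
    ultimately show "(\<lambda>s. indicator {y..t} s *\<^sub>R prod ((s - y) powr (\<beta> - 1) *\<^sub>R G s) (g y)) \<in> borel_measurable borel"
      by (simp only: Fy)
  qed
  have F_int: "integrable (lborel \<Otimes>\<^sub>M lborel) F"
  proof (rule lborel_pair.Fubini_integrable[OF F_meas])
    have "bounded (g ` {a..t})"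
      by (intro compact_imp_bounded compact_continuous_image g) auto
    then obtain C where C: "\<And>y. y \<in> {a..t} \<Longrightarrow> norm (g y) \<le> C"
      unfolding bounded_iff by blast
    obtain K where K: "K \<ge> 0" "\<And>x y. norm (prod x y) \<le> norm x * norm y * K"
      using prod.nonneg_bounded by blast
    define D where "D = (t - a) powr \<beta> / \<beta> * \<bar>C\<bar> * K"
    have "set_integrable lborel {a..t} G"
      using G_int G_meas by (rule set_integrable_lborelI)
    then have int_G: "integrable lborel (\<lambda>s. D * norm (G' s))"
      unfolding set_integrable_def G'_def[symmetric] by (intro integrable_mult_right integrable_norm)
    show "AE s in lborel. integrable lborel (\<lambda>y. F (s, y))"
    proof (rule AE_I2)
      fix s show "integrable lborel (\<lambda>y. F (s, y))"
        using sec_s[of s] by (cases "s \<in> {a..t}") (auto simp: Fs Fs0 set_integrable_def)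
    qed
    show "integrable lborel (\<lambda>s. LINT y|lborel. norm (F (s, y)))"
    proof (rule Bochner_Integration.integrable_bound[OF int_G])
      show "(\<lambda>s. LINT y|lborel. norm (F (s, y))) \<in> borel_measurable lborel"
        by measurable
      have "(LINT y|lborel. norm (F (s, y))) \<le> D * norm (G' s)" for s
      proof (cases "s \<in> {a..t}")
        case s: True
        have k_int: "set_integrable lborel {a..s} (\<lambda>y. (s - y) powr (\<beta> - 1))"
          by (rule set_integrable_lborelI[OF kernel_abs_integrable[OF \<beta>]]) measurable
        have "(LINT y|lborel. norm (F (s, y)))
            \<le> (LINT y|lborel. norm (G s) * \<bar>C\<bar> * K * (indicator {a..s} y *\<^sub>R (s - y) powr (\<beta> - 1)))"
        proof (rule integral_mono)
          show "integrable lborel (\<lambda>y. norm (F (s, y)))"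
            by (intro integrable_norm) (use sec_s[OF s] in \<open>simp add: Fs[OF s] set_integrable_def\<close>)
          show "integrable lborel (\<lambda>y. norm (G s) * \<bar>C\<bar> * K * (indicator {a..s} y *\<^sub>R (s - y) powr (\<beta> - 1)))"
            using k_int unfolding set_integrable_def by (rule integrable_mult_right)
          show "norm (F (s, y)) \<le> norm (G s) * \<bar>C\<bar> * K * (indicator {a..s} y *\<^sub>R (s - y) powr (\<beta> - 1))" for y
          proof (cases "y \<in> {a..s}")
            case True
            then have "norm (g y) \<le> \<bar>C\<bar>" using C[of y] s by auto
            then have "norm (prod (G s) (g y)) \<le> norm (G s) * \<bar>C\<bar> * K"
              using K(1) by (intro order_trans[OF K(2)] mult_right_mono mult_left_mono) auto
            then have "(s - y) powr (\<beta> - 1) * norm (prod (G s) (g y)) \<le> (s - y) powr (\<beta> - 1) * (norm (G s) * \<bar>C\<bar> * K)"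
              by (intro mult_left_mono) auto
            then show ?thesis using True
              by (simp add: Fs[OF s] prod.scaleR_right mult_ac)
          qed (simp add: Fs[OF s])
        qed
        also have "\<dots> = norm (G s) * \<bar>C\<bar> * K * ((s - a) powr \<beta> / \<beta>)"
        proof -
          have "(LINT y:{a..s}|lborel. (s - y) powr (\<beta> - 1)) = (s - a) powr \<beta> / \<beta>"
            using set_borel_integral_eq_integral(2)[OF k_int] s
              integral_unique[OF kernel_has_integral[OF \<beta>, of a s]] by simp
          then show ?thesis by (simp add: set_lebesgue_integral_def)
        qed
        also have "\<dots> \<le> norm (G s) * \<bar>C\<bar> * K * ((t - a) powr \<beta> / \<beta>)"
          using s \<beta> K(1) by (intro mult_left_mono divide_right_mono powr_mono2) auto
        finally show ?thesis using s by (simp add: D_def G'_def mult_ac)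
      next
        case False
        then show ?thesis by (simp add: Fs0 G'_def)
      qed
      then show "AE s in lborel. norm (LINT y|lborel. norm (F (s, y))) \<le> norm (D * norm (G' s))"
        by (intro AE_I2) (simp add: order_trans[OF _ abs_ge_self])
    qed
  qed
  have inner_s: "(LINT y|lborel. F (s, y)) =
      indicator {a..t} s *\<^sub>R prod (G s) (integral {a..s} (\<lambda>y. (s - y) powr (\<beta> - 1) *\<^sub>R g y))" for s
  proof (cases "s \<in> {a..t}")
    case s: True
    have "(LINT y|lborel. F (s, y)) = integral {a..s} (\<lambda>y. prod (G s) ((s - y) powr (\<beta> - 1) *\<^sub>R g y))"
      using set_borel_integral_eq_integral(2)[OF sec_s[OF s]] by (simp add: Fs[OF s] set_lebesgue_integral_def)
    also have "\<dots> = prod (G s) (integral {a..s} (\<lambda>y. (s - y) powr (\<beta> - 1) *\<^sub>R g y))"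
      using integral_linear[OF set_lebesgue_integral_eq_integral(1)[OF kg_int[OF s]] prod.bounded_linear_right[of "G s"]]
      by (simp add: o_def)
    finally show ?thesis using s by simp
  qed (simp add: Fs0)
  have inner_y: "(LINT s|lborel. F (s, y)) =
      indicator {a..t} y *\<^sub>R prod (integral {y..t} (\<lambda>s. (s - y) powr (\<beta> - 1) *\<^sub>R G s)) (g y)" for y
  proof -
    have "y \<notin> {a..t} \<or> (y = t \<and> a \<le> t) \<or> y \<in> {a..<t}" by auto
    then consider "y \<notin> {a..t}" | "y = t" "a \<le> t" | "y \<in> {a..<t}" by blast
    then show ?thesis
    proof cases
      case 1 then show ?thesis by (simp add: Fy0)
    next
      case 2
      \<comment> \<open>The section over \<open>y = t\<close> is supported on the single point \<open>s = t\<close>.\<close>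
      have "AE s in lborel. F (s, y) = 0"
        using AE_lborel_singleton[of t] by eventually_elim (use 2 in \<open>auto simp: Fy indicator_def\<close>)
      then have "(LINT s|lborel. F (s, y)) = 0"
        by (rule integral_eq_zero_AE)
      then show ?thesis using 2 by (simp add: prod.zero_left)
    next
      case y: 3
      then have y': "y \<in> {a..t}" by auto
      have "(LINT s|lborel. F (s, y)) = integral {y..t} (\<lambda>s. prod ((s - y) powr (\<beta> - 1) *\<^sub>R G s) (g y))"
        using set_borel_integral_eq_integral(2)[OF sec_y[OF y]] by (simp add: Fy[OF y'] set_lebesgue_integral_def)
      also have "\<dots> = prod (integral {y..t} (\<lambda>s. (s - y) powr (\<beta> - 1) *\<^sub>R G s)) (g y)"
        using integral_linear[OF set_lebesgue_integral_eq_integral(1)[OF kG_int[OF y]] prod.bounded_linear_left[of "g y"]]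
        by (simp add: o_def)
      finally show ?thesis using y' by simp
    qed
  qed
  have F_int': "integrable (lborel \<Otimes>\<^sub>M lborel) (case_prod (\<lambda>s y. F (s, y)))"
    using F_int by (simp add: case_prod_beta')
  have "(LINT s|lborel. LINT y|lborel. F (s, y)) = (LINT y|lborel. LINT s|lborel. F (s, y))"
    using lborel_pair.Fubini_integral[OF F_int'] by simp
  moreover have "set_integrable lborel {a..t} (\<lambda>s. prod (G s) (integral {a..s} (\<lambda>y. (s - y) powr (\<beta> - 1) *\<^sub>R g y)))"
    using lborel_pair.integrable_fst[OF F_int'] unfolding set_integrable_def by (simp add: inner_s)
  moreover have "set_integrable lborel {a..t} (\<lambda>y. prod (integral {y..t} (\<lambda>s. (s - y) powr (\<beta> - 1) *\<^sub>R G s)) (g y))"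
    using lborel_pair.integrable_snd[OF F_int'] unfolding set_integrable_def by (simp add: inner_y)
  ultimately show ?thesis
    unfolding inner_s inner_y set_lebesgue_integral_def[symmetric]
    by (simp only: set_borel_integral_eq_integral(2))
qed

section \<open>Integration by parts and the composition law\<close>

lemma frac_int_right_reflect:
  fixes g :: "real \<Rightarrow> 'a::euclidean_space"
  shows "frac_int_right b \<beta> g t = frac_int_left (- b) \<beta> (\<lambda>s. g (- s)) (- t)"
proof -
  have "integral {- b..- t} (\<lambda>y. (- t - y) powr (\<beta> - 1) *\<^sub>R g (- y))
      = integral {t..b} (\<lambda>y. (y - t) powr (\<beta> - 1) *\<^sub>R g y)"
    using Henstock_Kurzweil_Integration.integral_reflect_real[of b t "\<lambda>y. (y - t) powr (\<beta> - 1) *\<^sub>R g y"]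
    by (simp add: minus_diff_commute)
  then show ?thesis by (simp add: frac_int_left_def frac_int_right_def)
qed

lemma frac_int_by_parts:
  fixes g h :: "real \<Rightarrow> 'a::euclidean_space"
  assumes \<beta>: "0 < \<beta>" and g: "continuous_on {a..b} g" and h: "continuous_on {a..b} h"
  shows "integral {a..b} (\<lambda>t. h t \<bullet> frac_int_left a \<beta> g t)
       = integral {a..b} (\<lambda>t. frac_int_right b \<beta> h t \<bullet> g t)"
proof -
  have "integral {a..b} (\<lambda>s. h s \<bullet> (integral {a..s} (\<lambda>y. (s - y) powr (\<beta> - 1) *\<^sub>R g y)))
       = integral {a..b} (\<lambda>y. (integral {y..b} (\<lambda>s. (s - y) powr (\<beta> - 1) *\<^sub>R h s)) \<bullet> g y)"
  proof (rule fubini_triangle_kernel[OF bounded_bilinear_inner \<beta> g])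
    show "h absolutely_integrable_on {a..b}"
      by (rule absolutely_integrable_continuous_real[OF h])
    show "(\<lambda>s. indicator {a..b} s *\<^sub>R h s) \<in> borel_measurable borel"
      by (rule borel_measurable_continuous_on_indicator[OF _ h]) auto
    fix y assume y: "y \<in> {a..<b}"
    have "continuous_on {- b..- y} (\<lambda>s. h (- s))"
      by (rule continuous_on_compose2[OF h]) (use y in \<open>auto intro!: continuous_intros\<close>)
    from kernel_scaleR_abs_integrable[OF \<beta> this]
    have "(\<lambda>s. (- y - s) powr (\<beta> - 1) *\<^sub>R h (- s)) absolutely_integrable_on {- b..- y}" .
    then show "(\<lambda>s. (s - y) powr (\<beta> - 1) *\<^sub>R h s) absolutely_integrable_on {y..b}"
      using absolutely_integrable_reflect_real[where f = "\<lambda>s. (s - y) powr (\<beta> - 1) *\<^sub>R h s" and a = y and b = b]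
      by (simp add: minus_diff_commute)
  qed
  then have "integral {a..b} (\<lambda>s. (1 / Gamma \<beta>) * (h s \<bullet> (integral {a..s} (\<lambda>y. (s - y) powr (\<beta> - 1) *\<^sub>R g y))))
       = integral {a..b} (\<lambda>y. (1 / Gamma \<beta>) * ((integral {y..b} (\<lambda>s. (s - y) powr (\<beta> - 1) *\<^sub>R h s)) \<bullet> g y))"
    by simp
  then show ?thesis using \<beta> by (simp add: frac_int_left_def frac_int_right_def)
qed

lemma beta_kernel_has_integral:
  fixes t y \<beta> :: real
  assumes "0 < \<beta>" and "\<beta> < 1" and "y < t"
  shows "((\<lambda>s. (s - y) powr (\<beta> - 1) * (t - s) powr (- \<beta>)) has_integral Gamma \<beta> * Gamma (1 - \<beta>)) {y..t}"
proof -
  have "Beta \<beta> (1 - \<beta>) = Gamma \<beta> * Gamma (1 - \<beta>)" by (simp add: Beta_def)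
  then have "((\<lambda>x. x powr (\<beta> - 1) * (1 - x) powr (- \<beta>)) has_integral Gamma \<beta> * Gamma (1 - \<beta>)) (cbox 0 1)"
    using has_integral_Beta_real[of \<beta> "1 - \<beta>"] assms by simp
  from has_integral_affinity[OF this, of "1 / (t - y)" "- y / (t - y)"]
  have "((\<lambda>s. (s / (t - y) - y / (t - y)) powr (\<beta> - 1) * (1 - (s / (t - y) - y / (t - y))) powr - \<beta>)
     has_integral (t - y) * (Gamma \<beta> * Gamma (1 - \<beta>))) ((\<lambda>s. (t - y) * s + y) ` {0..1})"
    using assms by simp
  moreover have "(\<lambda>s. (t - y) * s + y) ` {0..1} = {y..t}"
    using assms by (simp add: image_affinity_atLeastAtMost)
  ultimately have "((\<lambda>s. (1 / (t - y)) * ((s / (t - y) - y / (t - y)) powr (\<beta> - 1) * (1 - (s / (t - y) - y / (t - y))) powr - \<beta>))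
     has_integral (1 / (t - y)) * ((t - y) * (Gamma \<beta> * Gamma (1 - \<beta>)))) {y..t}"
    by (intro has_integral_mult_right) simp
  then have "((\<lambda>s. (1 / (t - y)) * ((s / (t - y) - y / (t - y)) powr (\<beta> - 1) * (1 - (s / (t - y) - y / (t - y))) powr - \<beta>))
     has_integral Gamma \<beta> * Gamma (1 - \<beta>)) {y..t}"
    using assms by simp
  then show ?thesis
  proof (rule has_integral_eq[rotated])
    fix s assume s: "s \<in> {y..t}"
    have "s / (t - y) - y / (t - y) = (s - y) / (t - y)" "1 - (s / (t - y) - y / (t - y)) = (t - s) / (t - y)"
      using assms by (auto simp: diff_divide_distrib[symmetric]) (simp add: divide_simps)
    then show "(1 / (t - y)) * ((s / (t - y) - y / (t - y)) powr (\<beta> - 1) * (1 - (s / (t - y) - y / (t - y))) powr - \<beta>)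
        = (s - y) powr (\<beta> - 1) * (t - s) powr (- \<beta>)"
      using s assms by (cases "s = y") (simp_all add: powr_divide powr_diff powr_minus_divide)
  qed
qed

text \<open>Exchanging the order of integration leaves the inner integral of \<open>beta_kernel_has_integral\<close>, whose
  value does not depend on the end points because the two exponents add up to \<open>-1\<close>.\<close>

lemma frac_int_left_compose:
  fixes g :: "real \<Rightarrow> 'a::euclidean_space"
  assumes \<beta>: "0 < \<beta>" "\<beta> < 1" and g: "continuous_on {a..t} g"
  shows "frac_int_left a (1 - \<beta>) (frac_int_left a \<beta> g) t = integral {a..t} g"
proof -
  have G: "Gamma \<beta> > 0" "Gamma (1 - \<beta>) > 0" using \<beta> by (simp_all add: Gamma_real_pos)
  have beta: "(\<lambda>s. (s - y) powr (\<beta> - 1) *\<^sub>R (t - s) powr (- \<beta>)) integrable_on {y..t}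
    \<and> integral {y..t} (\<lambda>s. (s - y) powr (\<beta> - 1) *\<^sub>R (t - s) powr (- \<beta>)) = Gamma \<beta> * Gamma (1 - \<beta>)"
    if "y < t" for y
    using beta_kernel_has_integral[OF \<beta> that] by (auto simp: integral_unique)
  have "integral {a..t} (\<lambda>s. (t - s) powr (- \<beta>) *\<^sub>R integral {a..s} (\<lambda>y. (s - y) powr (\<beta> - 1) *\<^sub>R g y))
      = integral {a..t} (\<lambda>y. integral {y..t} (\<lambda>s. (s - y) powr (\<beta> - 1) *\<^sub>R (t - s) powr (- \<beta>)) *\<^sub>R g y)"
  proof (rule fubini_triangle_kernel[OF bounded_bilinear_scaleR \<beta>(1) g])
    show "(\<lambda>s. (t - s) powr (- \<beta>)) absolutely_integrable_on {a..t}"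
      using kernel_abs_integrable[of "1 - \<beta>" a t] \<beta> by simp
    show "(\<lambda>s. (s - y) powr (\<beta> - 1) *\<^sub>R (t - s) powr (- \<beta>)) absolutely_integrable_on {y..t}"
      if "y \<in> {a..<t}" for y
      by (rule nonnegative_absolutely_integrable_1) (use beta[of y] that in auto)
  qed measurable
  also have "\<dots> = integral {a..t} (\<lambda>y. (Gamma \<beta> * Gamma (1 - \<beta>)) *\<^sub>R g y)"
    by (rule integral_spike[of "{t}"]) (use beta in auto)
  finally have "integral {a..t} (\<lambda>s. (t - s) powr (- \<beta>) *\<^sub>R integral {a..s} (\<lambda>y. (s - y) powr (\<beta> - 1) *\<^sub>R g y))
      = (Gamma \<beta> * Gamma (1 - \<beta>)) *\<^sub>R integral {a..t} g"
    by simp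
  then have "(1 / (Gamma \<beta> * Gamma (1 - \<beta>))) *\<^sub>R integral {a..t} (\<lambda>s. (t - s) powr (- \<beta>) *\<^sub>R integral {a..s} (\<lambda>y. (s - y) powr (\<beta> - 1) *\<^sub>R g y))
      = integral {a..t} g"
    using G by simp
  moreover have "frac_int_left a (1 - \<beta>) (frac_int_left a \<beta> g) t =
      (1 / Gamma (1 - \<beta>)) *\<^sub>R integral {a..t} (\<lambda>s. (1 / Gamma \<beta>) *\<^sub>R (t - s) powr (- \<beta>) *\<^sub>R integral {a..s} (\<lambda>y. (s - y) powr (\<beta> - 1) *\<^sub>R g y))"
    using \<beta> by (simp add: frac_int_left_def mult.commute)
  ultimately show ?thesis by (simp only: integral_cmul) (simp add: mult.commute)
qed

section \<open>Volterra equations with weakly singular kernel\<close>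

text \<open>The rate \<open>c\<close> of the exponential weight for which \<open>M I\<^bsup>\<alpha>\<^esup>\<close> has norm \<open>M / (2 M + 1) < 1 / 2\<close>. The summand \<open>1\<close>
  keeps the denominator positive for \<open>M = 0\<close>.\<close>

lemma bielecki_rate:
  fixes \<alpha> M :: real
  assumes "0 < \<alpha>" and "0 \<le> M"
  obtains c where "0 < c" and "c powr (- \<alpha>) = 1 / (2 * M + 1)"
proof
  show "0 < (2 * M + 1) powr (1 / \<alpha>)" using assms by simp
  have "((2 * M + 1) powr (1 / \<alpha>)) powr (- \<alpha>) = (2 * M + 1) powr (- 1)"
    using assms by (simp add: powr_powr)
  also have "\<dots> = 1 / (2 * M + 1)" using assms by (simp add: powr_minus_divide)
  finally show "((2 * M + 1) powr (1 / \<alpha>)) powr (- \<alpha>) = 1 / (2 * M + 1)" .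
qed

text \<open>A Gronwall inequality for the fractional integral: at the maximum of \<open>exp (- c t) * norm (\<delta> t)\<close> the
  contribution of \<open>\<delta>\<close> to its own bound is at most half of it and can be absorbed. The integrand \<open>r\<close> is
  left abstract because both the difference of two solutions (\<open>\<epsilon> = 0\<close>) and the response to a perturbation of the
  equation have this form, and \<open>K\<close> is chosen before all of them.\<close>

lemma volterra_a_priori_bound:
  fixes \<alpha> M a b :: real
  assumes \<alpha>: "0 < \<alpha>" and M: "0 \<le> M" and ab: "a \<le> b"
  obtains K where "0 < K" and
    "\<And>(\<delta> :: real \<Rightarrow> 'a::euclidean_space) r \<epsilon> t. \<lbrakk>continuous_on {a..b} \<delta>; continuous_on {a..b} r; 0 \<le> \<epsilon>;
       \<And>t. t \<in> {a..b} \<Longrightarrow> \<delta> t = frac_int_left a \<alpha> r t;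
       \<And>t. t \<in> {a..b} \<Longrightarrow> norm (r t) \<le> M * norm (\<delta> t) + \<epsilon>; t \<in> {a..b}\<rbrakk> \<Longrightarrow> norm (\<delta> t) \<le> K * \<epsilon>"
proof -
  obtain c where c: "0 < c" "c powr (- \<alpha>) = 1 / (2 * M + 1)"
    using bielecki_rate[OF \<alpha> M] .
  show ?thesis
  proof (rule that[of "exp (c * (b - a))"])
    fix \<delta> r :: "real \<Rightarrow> 'a" and \<epsilon> t :: real
    assume \<delta>: "continuous_on {a..b} \<delta>" and r: "continuous_on {a..b} r" and \<epsilon>: "0 \<le> \<epsilon>"
      and eq: "\<And>t. t \<in> {a..b} \<Longrightarrow> \<delta> t = frac_int_left a \<alpha> r t"
      and le: "\<And>t. t \<in> {a..b} \<Longrightarrow> norm (r t) \<le> M * norm (\<delta> t) + \<epsilon>" and t: "t \<in> {a..b}"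
    \<comment> \<open>\<open>S\<close> below is the weighted supremum norm of \<open>\<delta>\<close>; it is attained at \<open>t0\<close>.\<close>
    have "\<exists>t0\<in>{a..b}. \<forall>y\<in>{a..b}. exp (- c * y) * norm (\<delta> y) \<le> exp (- c * t0) * norm (\<delta> t0)"
      by (rule continuous_attains_sup) (use ab \<delta> in \<open>auto intro!: continuous_intros\<close>)
    then obtain t0 where t0: "t0 \<in> {a..b}"
      and sup: "\<And>y. y \<in> {a..b} \<Longrightarrow> exp (- c * y) * norm (\<delta> y) \<le> exp (- c * t0) * norm (\<delta> t0)"
      by blast
    define S where "S = exp (- c * t0) * norm (\<delta> t0)"
    have S: "0 \<le> S" by (simp add: S_def)
    have \<delta>_le: "norm (\<delta> y) \<le> S * exp (c * y)" if "y \<in> {a..b}" for y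
      using sup[OF that] by (simp add: S_def exp_minus field_simps)
    have r_le: "norm (r y) \<le> (M * S + \<epsilon> * exp (- c * a)) * exp (c * y)" if y: "y \<in> {a..t0}" for y
    proof -
      have y': "y \<in> {a..b}" using y t0 by auto
      have "1 \<le> exp (- c * a) * exp (c * y)"
        using y c(1) by (simp add: mult_left_mono flip: exp_add)
      then have "\<epsilon> * 1 \<le> \<epsilon> * (exp (- c * a) * exp (c * y))" using \<epsilon> by (rule mult_left_mono)
      moreover have "M * norm (\<delta> y) \<le> M * (S * exp (c * y))"
        using \<delta>_le[OF y'] M by (rule mult_left_mono)
      ultimately show ?thesis using le[OF y'] by (simp add: algebra_simps)
    qed
    have "norm (\<delta> t0) \<le> (M * S + \<epsilon> * exp (- c * a)) * c powr (- \<alpha>) * exp (c * t0)"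
      unfolding eq[OF t0]
      by (rule norm_frac_int_left_exp_le[OF \<alpha> c(1)])
        (use r_le t0 M S \<epsilon> r in \<open>auto intro: continuous_on_subset\<close>)
    moreover have "norm (\<delta> t0) = S * exp (c * t0)" by (simp add: S_def exp_minus)
    ultimately have "S \<le> (M * S + \<epsilon> * exp (- c * a)) * c powr (- \<alpha>)" by simp
    then have "S * (2 * M + 1) \<le> M * S + \<epsilon> * exp (- c * a)"
      using M unfolding c(2) by (simp add: field_simps)
    moreover have "0 \<le> M * S" using M S by simp
    ultimately have "S \<le> \<epsilon> * exp (- c * a)" by (simp add: algebra_simps)
    then have "S * exp (c * t) \<le> \<epsilon> * exp (- c * a) * exp (c * t)" by (rule mult_right_mono) simp
    also have "\<dots> = \<epsilon> * exp (c * (t - a))" by (simp add: algebra_simps flip: exp_add)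
    also have "\<dots> \<le> \<epsilon> * exp (c * (b - a))"
      using \<epsilon> c(1) t by (intro mult_left_mono) auto
    finally show "norm (\<delta> t) \<le> exp (c * (b - a)) * \<epsilon>"
      using \<delta>_le[OF t] by (simp add: mult.commute)
  qed simp
qed

text \<open>Banach's fixed point theorem for \<open>x t = exp (- c t) q t\<close>: in this variable the weighted norm is the
  supremum norm. Functions on \<open>{a..b}\<close> are extended to constants outside by \<open>cl\<close>, so that they live in the
  complete space of bounded continuous functions on the line.\<close>

lemma volterra_exists:
  fixes F :: "real \<Rightarrow> 'a::euclidean_space \<Rightarrow> 'a"
  assumes \<alpha>: "0 < \<alpha>" and ab: "a \<le> b" and M: "0 \<le> M"
    and F: "continuous_on ({a..b} \<times> UNIV) (\<lambda>(t, x). F t x)"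
    and Lip: "\<And>t x y. t \<in> {a..b} \<Longrightarrow> norm (F t x - F t y) \<le> M * norm (x - y)"
  obtains q where "continuous_on {a..b} q"
    and "\<And>t. t \<in> {a..b} \<Longrightarrow> q t = A + frac_int_left a \<alpha> (\<lambda>s. F s (q s)) t"
proof -
  obtain c where c: "0 < c" "c powr (- \<alpha>) = 1 / (2 * M + 1)"
    using bielecki_rate[OF \<alpha> M] .
  define cl where "cl t = max a (min b t)" for t
  have cl: "cl t \<in> {a..b}" "t \<in> {a..b} \<Longrightarrow> cl t = t" for t
    using ab by (auto simp: cl_def)
  have cl_cont: "continuous_on UNIV cl"
    unfolding cl_def[abs_def] by (intro continuous_intros)
  define G where "G x s = F s (exp (c * s) *\<^sub>R apply_bcontfun x s)" for x s
  have G_cont: "continuous_on {a..b} (G x)" for x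
    unfolding G_def[abs_def]
    by (rule continuous_on_compose2[OF F, of _ "\<lambda>s. (s, exp (c * s) *\<^sub>R apply_bcontfun x s)", simplified])
      (auto intro!: continuous_intros)
  define N where "N x t = exp (- c * cl t) *\<^sub>R (A + frac_int_left a \<alpha> (G x) (cl t))" for x t
  have N: "N x \<in> bcontfun" for x
  proof -
    have cont: "continuous_on {a..b} (\<lambda>s. exp (- c * s) *\<^sub>R (A + frac_int_left a \<alpha> (G x) s))"
      by (intro continuous_intros continuous_on_frac_int_left \<alpha> G_cont)
    have "continuous_on UNIV (N x)"
      unfolding N_def[abs_def]
      by (rule continuous_on_compose2[OF cont cl_cont]) (use cl in auto)
    moreover have "bounded (range (N x))"
    proof (rule bounded_subset)
      show "bounded ((\<lambda>s. exp (- c * s) *\<^sub>R (A + frac_int_left a \<alpha> (G x) s)) ` {a..b})"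
        by (intro compact_imp_bounded compact_continuous_image cont) auto
    qed (use cl in \<open>auto simp: N_def\<close>)
    ultimately show ?thesis by (simp add: bcontfun_def)
  qed
  define T where "T x = Bcontfun (N x)" for x
  have T: "apply_bcontfun (T x) = N x" for x
    unfolding T_def by (rule Bcontfun_inverse[OF N])
  have contraction: "dist (T x) (T y) \<le> 1 / 2 * dist x y" for x y
  proof (rule dist_bound)
    fix t
    define s where "s = cl t"
    have s: "s \<in> {a..b}" using cl by (simp add: s_def)
    have sub: "continuous_on {a..s} (G z)" for z
      by (rule continuous_on_subset[OF G_cont]) (use s in auto)
    have "norm (frac_int_left a \<alpha> (\<lambda>w. G x w - G y w) s) \<le> M * dist x y * c powr (- \<alpha>) * exp (c * s)"
    proof (rule norm_frac_int_left_exp_le[OF \<alpha> c(1)])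
      show "norm (G x w - G y w) \<le> M * dist x y * exp (c * w)" if "w \<in> {a..s}" for w
      proof -
        have "norm (G x w - G y w) \<le> M * norm (exp (c * w) *\<^sub>R apply_bcontfun x w - exp (c * w) *\<^sub>R apply_bcontfun y w)"
          unfolding G_def by (rule Lip) (use that s in auto)
        also have "\<dots> = M * (exp (c * w) * dist (apply_bcontfun x w) (apply_bcontfun y w))"
          by (simp add: dist_norm flip: scaleR_diff_right)
        also have "\<dots> \<le> M * (exp (c * w) * dist x y)"
          using M by (intro mult_left_mono dist_bounded) auto
        finally show ?thesis by (simp add: mult_ac)
      qed
    qed (use M s sub in \<open>auto intro!: continuous_intros\<close>)
    also have "frac_int_left a \<alpha> (\<lambda>w. G x w - G y w) s = frac_int_left a \<alpha> (G x) s - frac_int_left a \<alpha> (G y) s"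
      by (rule frac_int_left_diff[OF \<alpha> sub sub])
    finally have "norm (frac_int_left a \<alpha> (G x) s - frac_int_left a \<alpha> (G y) s) \<le> (M / (2 * M + 1) * dist x y) * exp (c * s)"
      by (simp add: c(2) mult_ac)
    also have "\<dots> \<le> (1 / 2 * dist x y) * exp (c * s)"
      using M by (intro mult_right_mono) (auto simp: field_simps)
    finally have le: "norm (frac_int_left a \<alpha> (G x) s - frac_int_left a \<alpha> (G y) s) \<le> (1 / 2 * dist x y) * exp (c * s)" .
    have "dist (T x t) (T y t) = exp (- c * s) * norm (frac_int_left a \<alpha> (G x) s - frac_int_left a \<alpha> (G y) s)"
      by (simp add: T N_def s_def dist_norm flip: scaleR_diff_right)
    also have "\<dots> \<le> exp (- c * s) * ((1 / 2 * dist x y) * exp (c * s))"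
      using le by (rule mult_left_mono) simp
    also have "\<dots> = 1 / 2 * dist x y" by (simp add: exp_minus)
    finally show "dist (T x t) (T y t) \<le> 1 / 2 * dist x y" .
  qed
  have "\<exists>!x. T x = x"
    by (rule banach_fix_type[where c = "1 / 2"]) (use contraction in auto)
  then obtain x where x: "T x = x" by blast
  define q where "q t = exp (c * t) *\<^sub>R apply_bcontfun x t" for t
  show ?thesis
  proof
    show "continuous_on {a..b} q"
      unfolding q_def[abs_def] by (auto intro!: continuous_intros)
    fix t assume t: "t \<in> {a..b}"
    have "G x = (\<lambda>s. F s (q s))" by (simp add: G_def q_def fun_eq_iff)
    moreover have "apply_bcontfun x t = N x t" using T[of x] x by simp
    ultimately show "q t = A + frac_int_left a \<alpha> (\<lambda>s. F s (q s)) t"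
      by (simp add: q_def N_def cl(2)[OF t] exp_minus)
  qed
qed

section \<open>Caputo equations as Volterra equations\<close>

lemma integral_eq_imp_eq:
  fixes g h :: "real \<Rightarrow> 'a::euclidean_space"
  assumes ab: "a < b" and g: "continuous_on {a..b} g" and h: "continuous_on {a..b} h"
    and eq: "\<And>t. t \<in> {a..b} \<Longrightarrow> integral {a..t} g = integral {a..t} h" and t: "t \<in> {a..b}"
  shows "g t = h t"
proof (rule vector_derivative_unique_within_closed_interval[OF ab])
  show "t \<in> cbox a b" using t by simp
  show "((\<lambda>u. integral {a..u} g) has_vector_derivative g t) (at t within cbox a b)"
    using integral_has_vector_derivative[OF g t] by simp
  show "((\<lambda>u. integral {a..u} g) has_vector_derivative h t) (at t within cbox a b)"
    unfolding interval_cbox[symmetric]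
    by (rule has_vector_derivative_transform[OF _ _ integral_has_vector_derivative[OF h t]])
      (use t eq in auto)
qed

text \<open>The derivative is required on the half-open interval only; continuity of \<open>\<phi>\<close> at \<open>a\<close> supplies what is
  missing there.\<close>

lemma antiderivative_iff_integral:
  fixes \<phi> g :: "real \<Rightarrow> 'a::euclidean_space"
  assumes \<phi>: "continuous_on {a..b} \<phi>" "\<phi> a = 0" and g: "continuous_on {a..b} g"
  shows "(\<forall>t\<in>{a<..b}. (\<phi> has_vector_derivative g t) (at t within {a<..b})) \<longleftrightarrow>
         (\<forall>t\<in>{a..b}. \<phi> t = integral {a..t} g)" (is "?L \<longleftrightarrow> ?R")
proof
  assume L: ?L
  show ?R
  proof
    fix t assume t: "t \<in> {a..b}"
    have "(g has_integral \<phi> t - \<phi> a) {a..t}"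
    proof (rule fundamental_theorem_of_calculus_interior)
      show "continuous_on {a..t} \<phi>" by (rule continuous_on_subset[OF \<phi>(1)]) (use t in auto)
      fix x assume x: "x \<in> {a<..<t}"
      then have "(\<phi> has_vector_derivative g x) (at x within {a<..b})" using L t by auto
      moreover have "at x within {a<..b} = at x"
        by (rule at_within_interior) (use x t in auto)
      ultimately show "(\<phi> has_vector_derivative g x) (at x)" by simp
    qed (use t in auto)
    then show "\<phi> t = integral {a..t} g" using \<phi>(2) by (simp add: integral_unique)
  qed
next
  assume R: ?R
  show ?L
  proof
    fix t assume t: "t \<in> {a<..b}"
    have "((\<lambda>u. integral {a..u} g) has_vector_derivative g t) (at t within {a<..b})"
      by (rule has_vector_derivative_within_subset[OF integral_has_vector_derivative[OF g]]) (use t in auto)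
    then show "(\<phi> has_vector_derivative g t) (at t within {a<..b})"
      by (rule has_vector_derivative_transform[rotated 2]) (use t R in auto)
  qed
qed

text \<open>The Caputo equation says \<open>I\<^bsup>1-\<alpha>\<^esup> (q - q a) = I\<^bsup>1\<^esup> g = I\<^bsup>1-\<alpha>\<^esup> I\<^bsup>\<alpha>\<^esup> g\<close>. The operator \<open>I\<^bsup>1-\<alpha>\<^esup>\<close> is injective on continuous
  functions, since applying \<open>I\<^bsup>\<alpha>\<^esup>\<close> to its values yields a plain integral, which can be differentiated. For \<open>\<alpha> = 1\<close>
  this is the fundamental theorem of calculus.\<close>

lemma caputo_left_iff_volterra:
  fixes q g :: "real \<Rightarrow> 'a::euclidean_space"
  assumes ab: "a < b" and \<alpha>: "0 < \<alpha>" "\<alpha> \<le> 1" and q: "continuous_on {a..b} q" and g: "continuous_on {a..b} g"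
  shows "(\<forall>t\<in>{a<..b}. has_Caputo_deriv_left a b \<alpha> q t (g t)) \<longleftrightarrow>
         (\<forall>t\<in>{a..b}. q t = q a + frac_int_left a \<alpha> g t)"
proof -
  define \<psi> where "\<psi> s = q s - q a" for s
  define \<phi> where "\<phi> = frac_int_left a (1 - \<alpha>) \<psi>"
  have \<psi>: "continuous_on {a..b} \<psi>"
    unfolding \<psi>_def[abs_def] by (intro continuous_intros q)
  have Ig: "continuous_on {a..b} (frac_int_left a \<alpha> g)"
    by (rule continuous_on_frac_int_left[OF \<alpha>(1) g])
  have sub: "continuous_on {a..t} k" if "continuous_on {a..b} k" "t \<in> {a..b}" for t and k :: "real \<Rightarrow> 'a"
    by (rule continuous_on_subset[OF that(1)]) (use that(2) in auto)
  have \<phi>: "continuous_on {a..b} \<phi>" "\<phi> a = 0"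
  proof -
    show "continuous_on {a..b} \<phi>"
    proof (cases "\<alpha> = 1")
      case True
      then have "\<phi> = \<psi>" by (simp add: \<phi>_def frac_int_left_def fun_eq_iff)
      then show ?thesis using \<psi> by simp
    next
      case False
      then show ?thesis unfolding \<phi>_def by (intro continuous_on_frac_int_left \<psi>) (use \<alpha> in auto)
    qed
    show "\<phi> a = 0" by (simp add: \<phi>_def frac_int_left_def \<psi>_def)
  qed
  have "(\<forall>t\<in>{a<..b}. has_Caputo_deriv_left a b \<alpha> q t (g t)) \<longleftrightarrow>
        (\<forall>t\<in>{a<..b}. (\<phi> has_vector_derivative g t) (at t within {a<..b}))"
    by (simp add: has_Caputo_deriv_left_def has_RL_deriv_left_def \<phi>_def \<psi>_def[abs_def])
  also have "\<dots> \<longleftrightarrow> (\<forall>t\<in>{a..b}. \<phi> t = integral {a..t} g)"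
    by (rule antiderivative_iff_integral[OF \<phi> g])
  also have "\<dots> \<longleftrightarrow> (\<forall>t\<in>{a..b}. \<psi> t = frac_int_left a \<alpha> g t)"
  proof (cases "\<alpha> = 1")
    case True
    then show ?thesis
      by (auto simp: \<phi>_def frac_int_left_one sub[OF g]) (simp_all add: frac_int_left_def)
  next
    case False
    then have \<alpha>': "\<alpha> < 1" "0 < 1 - \<alpha>" "1 - \<alpha> < 1" using \<alpha> by auto
    have comp: "frac_int_left a (1 - \<alpha>) (frac_int_left a \<alpha> g) t = integral {a..t} g" if "t \<in> {a..b}" for t
      by (rule frac_int_left_compose[OF \<alpha>(1) \<alpha>'(1) sub[OF g that]])
    show ?thesis
    proof
      assume eq: "\<forall>t\<in>{a..b}. \<phi> t = integral {a..t} g"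
      show "\<forall>t\<in>{a..b}. \<psi> t = frac_int_left a \<alpha> g t"
      proof
        fix t assume t: "t \<in> {a..b}"
        show "\<psi> t = frac_int_left a \<alpha> g t"
        proof (rule integral_eq_imp_eq[OF ab \<psi> Ig _ t])
          fix s assume s: "s \<in> {a..b}"
          have "integral {a..s} \<psi> = frac_int_left a (1 - (1 - \<alpha>)) (frac_int_left a (1 - \<alpha>) \<psi>) s"
            by (rule frac_int_left_compose[OF \<alpha>'(2,3) sub[OF \<psi> s], symmetric])
          also have "\<dots> = frac_int_left a (1 - (1 - \<alpha>)) (frac_int_left a (1 - \<alpha>) (frac_int_left a \<alpha> g)) s"
            by (rule frac_int_left_cong) (use s eq comp in \<open>auto simp: \<phi>_def\<close>)
          also have "\<dots> = integral {a..s} (frac_int_left a \<alpha> g)"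
            by (rule frac_int_left_compose[OF \<alpha>'(2,3) sub[OF Ig s]])
          finally show "integral {a..s} \<psi> = integral {a..s} (frac_int_left a \<alpha> g)" .
        qed
      qed
    next
      assume eq: "\<forall>t\<in>{a..b}. \<psi> t = frac_int_left a \<alpha> g t"
      show "\<forall>t\<in>{a..b}. \<phi> t = integral {a..t} g"
      proof
        fix t assume t: "t \<in> {a..b}"
        have "\<phi> t = frac_int_left a (1 - \<alpha>) (frac_int_left a \<alpha> g) t"
          unfolding \<phi>_def by (rule frac_int_left_cong) (use t eq in auto)
        then show "\<phi> t = integral {a..t} g" using comp[OF t] by simp
      qed
    qed
  qed
  finally show ?thesis by (auto simp: \<psi>_def algebra_simps)
qed

lemma has_vector_derivative_reflect:
  fixes \<phi> :: "real \<Rightarrow> 'a::real_normed_vector"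
  shows "((\<lambda>s. \<phi> (- s)) has_vector_derivative - D) (at (- t) within uminus ` S) \<longleftrightarrow>
         (\<phi> has_vector_derivative D) (at t within S)"
proof -
  have *: "((\<lambda>s. \<phi> (- s)) has_vector_derivative - D) (at (- t) within uminus ` S)"
    if "(\<phi> has_vector_derivative D) (at t within S)" for \<phi> :: "real \<Rightarrow> 'a" and D t S
  proof -
    have "((\<phi> \<circ> uminus) has_vector_derivative (- 1) *\<^sub>R D) (at (- t) within uminus ` S)"
      by (rule vector_diff_chain_within)
        (use that in \<open>auto intro!: derivative_eq_intros simp: image_image\<close>)
    then show ?thesis by (simp add: o_def)
  qed
  show ?thesis
    using *[of \<phi> D t S] *[of "\<lambda>s. \<phi> (- s)" "- D" "- t" "uminus ` S"]
    by (auto simp: image_image)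
qed

lemma caputo_right_reflect:
  "has_Caputo_deriv_right a b \<alpha> p t D \<longleftrightarrow> has_Caputo_deriv_left (- b) (- a) \<alpha> (\<lambda>s. p (- s)) (- t) D"
proof -
  have "uminus ` {a..<b} = {- b<..- a}"
    by (auto simp: image_iff intro!: bexI[where x = "- _"])
  then show ?thesis
    using has_vector_derivative_reflect[of "frac_int_right b (1 - \<alpha>) (\<lambda>s. p s - p b)" "- D" t "{a..<b}"]
    by (simp add: has_Caputo_deriv_left_def has_Caputo_deriv_right_def has_RL_deriv_left_def
        has_RL_deriv_right_def frac_int_right_reflect)
qed

lemma continuous_on_reflect:
  fixes g :: "real \<Rightarrow> 'a::topological_space"
  shows "continuous_on {a..b} g \<Longrightarrow> continuous_on {- b..- a} (\<lambda>s. g (- s))"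
  by (erule continuous_on_compose2) (auto intro!: continuous_intros)

lemma continuous_on_frac_int_right:
  fixes g :: "real \<Rightarrow> 'a::euclidean_space"
  assumes "0 < \<beta>" and "continuous_on {a..b} g"
  shows "continuous_on {a..b} (frac_int_right b \<beta> g)"
proof -
  have "continuous_on {- b..- a} (frac_int_left (- b) \<beta> (\<lambda>s. g (- s)))"
    by (intro continuous_on_frac_int_left continuous_on_reflect assms)
  from continuous_on_reflect[OF this] show ?thesis
    by (simp add: frac_int_right_reflect[abs_def])
qed

lemma caputo_right_iff_volterra:
  fixes p g :: "real \<Rightarrow> 'a::euclidean_space"
  assumes ab: "a < b" and \<alpha>: "0 < \<alpha>" "\<alpha> \<le> 1" and p: "continuous_on {a..b} p" and g: "continuous_on {a..b} g"
  shows "(\<forall>t\<in>{a..<b}. has_Caputo_deriv_right a b \<alpha> p t (g t)) \<longleftrightarrow>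
         (\<forall>t\<in>{a..b}. p t = p b + frac_int_right b \<alpha> g t)"
proof -
  have "(\<forall>t\<in>{a..<b}. has_Caputo_deriv_right a b \<alpha> p t (g t)) \<longleftrightarrow>
        (\<forall>s\<in>{- b<..- a}. has_Caputo_deriv_left (- b) (- a) \<alpha> (\<lambda>s. p (- s)) s (g (- s)))"
    unfolding caputo_right_reflect
  proof (intro iffI ballI)
    fix s assume "\<forall>t\<in>{a..<b}. has_Caputo_deriv_left (- b) (- a) \<alpha> (\<lambda>s. p (- s)) (- t) (g t)" "s \<in> {- b<..- a}"
    then show "has_Caputo_deriv_left (- b) (- a) \<alpha> (\<lambda>s. p (- s)) s (g (- s))"
      by (auto dest!: bspec[of _ _ "- s"])
  next
    fix t assume "\<forall>s\<in>{- b<..- a}. has_Caputo_deriv_left (- b) (- a) \<alpha> (\<lambda>s. p (- s)) s (g (- s))" "t \<in> {a..<b}"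
    then show "has_Caputo_deriv_left (- b) (- a) \<alpha> (\<lambda>s. p (- s)) (- t) (g t)"
      by (auto dest!: bspec[of _ _ "- t"])
  qed
  also have "\<dots> \<longleftrightarrow> (\<forall>s\<in>{- b..- a}. p (- s) = p (- (- b)) + frac_int_left (- b) \<alpha> (\<lambda>s. g (- s)) s)"
    by (rule caputo_left_iff_volterra) (use assms in \<open>auto intro!: continuous_on_reflect\<close>)
  also have "\<dots> \<longleftrightarrow> (\<forall>t\<in>{a..b}. p t = p b + frac_int_right b \<alpha> g t)"
    unfolding frac_int_right_reflect
  proof (intro iffI ballI)
    fix t assume H: "\<forall>s\<in>{- b..- a}. p (- s) = p (- (- b)) + frac_int_left (- b) \<alpha> (\<lambda>s. g (- s)) s" "t \<in> {a..b}"
    show "p t = p b + frac_int_left (- b) \<alpha> (\<lambda>s. g (- s)) (- t)"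
      using bspec[OF H(1), of "- t"] H(2) by simp
  next
    fix s assume H: "\<forall>t\<in>{a..b}. p t = p b + frac_int_left (- b) \<alpha> (\<lambda>s. g (- s)) (- t)" "s \<in> {- b..- a}"
    show "p (- s) = p (- (- b)) + frac_int_left (- b) \<alpha> (\<lambda>s. g (- s)) s"
      using bspec[OF H(1), of "- s"] H(2) by simp
  qed
  finally show ?thesis .
qed

lemma Ck_on_imp_continuous_on: "Ck_on k S g \<Longrightarrow> continuous_on S g"
  by (cases k) (auto simp: continuous_on_eq_continuous_within intro: has_vector_derivative_continuous)

text \<open>The required smoothness of order \<open>\<lfloor>\<alpha>\<rfloor>\<close> is automatic for solutions of the integral equation; in particular
  the one-sided derivative at the missing endpoint exists when \<open>\<alpha> = 1\<close>.\<close>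

lemma frac_int_left_solution_Ck:
  fixes g :: "real \<Rightarrow> 'a::euclidean_space"
  assumes \<alpha>: "0 < \<alpha>" "\<alpha> \<le> 1" and g: "continuous_on {a..b} g"
    and q: "\<And>t. t \<in> {a..b} \<Longrightarrow> q t = A + frac_int_left a \<alpha> g t"
  shows "Ck_on (nat \<lfloor>\<alpha>\<rfloor>) {a..b} q"
proof (cases "\<alpha> = 1")
  case True
  have q': "q t = A + integral {a..t} g" if "t \<in> {a..b}" for t
    using q[OF that] frac_int_left_one[of a t g] g that True by (simp add: continuous_on_subset)
  have "(q has_vector_derivative g t) (at t within {a..b})" if t: "t \<in> {a..b}" for t
  proof (rule has_vector_derivative_transform[OF t q'])
    show "((\<lambda>t. A + integral {a..t} g) has_vector_derivative g t) (at t within {a..b})"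
      using has_vector_derivative_add[OF has_vector_derivative_const integral_has_vector_derivative[OF g t]]
      by simp
  qed
  then have "Ck_on (Suc 0) {a..b} q" using g by (auto intro!: exI[where x = g])
  then show ?thesis using True by simp
next
  case False
  then have "nat \<lfloor>\<alpha>\<rfloor> = 0" using \<alpha> by (simp add: floor_eq_iff)
  moreover have "continuous_on {a..b} q"
    by (rule continuous_on_eq[of _ "\<lambda>t. A + frac_int_left a \<alpha> g t"])
      (use q in \<open>auto intro!: continuous_intros continuous_on_frac_int_left \<alpha> g\<close>)
  ultimately show ?thesis by simp
qed

lemma frac_int_right_solution_Ck:
  fixes g :: "real \<Rightarrow> 'a::euclidean_space"
  assumes \<alpha>: "0 < \<alpha>" "\<alpha> \<le> 1" and g: "continuous_on {a..b} g"
    and p: "\<And>t. t \<in> {a..b} \<Longrightarrow> p t = B + frac_int_right b \<alpha> g t"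
  shows "Ck_on (nat \<lfloor>\<alpha>\<rfloor>) {a..b} p"
proof (cases "\<alpha> = 1")
  case True
  have p': "p t = (B + integral {a..b} g) - integral {a..t} g" if t: "t \<in> {a..b}" for t
  proof -
    have "integral {t..b} (\<lambda>y. (y - t) powr (1 - 1) *\<^sub>R g y) = integral {t..b} g"
      by (rule integral_spike[of "{t}"]) auto
    then have "frac_int_right b 1 g t = integral {t..b} g" by (simp add: frac_int_right_def)
    moreover have "integral {a..t} g + integral {t..b} g = integral {a..b} g"
      by (rule Henstock_Kurzweil_Integration.integral_combine)
        (use t in \<open>auto intro: integrable_continuous_real g\<close>)
    ultimately show ?thesis using p[OF t] True by (simp add: algebra_simps)
  qed
  have "(p has_vector_derivative - g t) (at t within {a..b})" if t: "t \<in> {a..b}" for t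
  proof (rule has_vector_derivative_transform[OF t p'])
    show "((\<lambda>t. (B + integral {a..b} g) - integral {a..t} g) has_vector_derivative - g t) (at t within {a..b})"
      using has_vector_derivative_diff[OF has_vector_derivative_const integral_has_vector_derivative[OF g t]]
      by simp
  qed
  then have "Ck_on (Suc 0) {a..b} p"
    using g by (auto intro!: exI[where x = "\<lambda>t. - g t"] continuous_intros)
  then show ?thesis using True by simp
next
  case False
  then have "nat \<lfloor>\<alpha>\<rfloor> = 0" using \<alpha> by (simp add: floor_eq_iff)
  moreover have "continuous_on {a..b} p"
    by (rule continuous_on_eq[of _ "\<lambda>t. B + frac_int_right b \<alpha> g t"])
      (use p in \<open>auto intro!: continuous_intros continuous_on_frac_int_right \<alpha> g\<close>)
  ultimately show ?thesis by simp
qed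

lemma volterra_unique:
  fixes F :: "real \<Rightarrow> 'a::euclidean_space \<Rightarrow> 'a"
  assumes \<alpha>: "0 < \<alpha>" and ab: "a \<le> b" and M: "0 \<le> M"
    and F: "continuous_on ({a..b} \<times> UNIV) (\<lambda>(t, x). F t x)"
    and Lip: "\<And>t x y. t \<in> {a..b} \<Longrightarrow> norm (F t x - F t y) \<le> M * norm (x - y)"
    and q1: "continuous_on {a..b} q1" "\<And>t. t \<in> {a..b} \<Longrightarrow> q1 t = A + frac_int_left a \<alpha> (\<lambda>s. F s (q1 s)) t"
    and q2: "continuous_on {a..b} q2" "\<And>t. t \<in> {a..b} \<Longrightarrow> q2 t = A + frac_int_left a \<alpha> (\<lambda>s. F s (q2 s)) t"
    and t: "t \<in> {a..b}"
  shows "q1 t = q2 t"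
proof -
  have cont: "continuous_on {a..b} (\<lambda>s. F s (q s))" if "continuous_on {a..b} q" for q
    by (rule continuous_on_compose2[OF F, of _ "\<lambda>s. (s, q s)", simplified])
      (auto intro!: continuous_intros that)
  obtain K where K: "0 < K"
    "\<And>(\<delta> :: real \<Rightarrow> 'a) r \<epsilon> t. \<lbrakk>continuous_on {a..b} \<delta>; continuous_on {a..b} r; 0 \<le> \<epsilon>;
       \<And>t. t \<in> {a..b} \<Longrightarrow> \<delta> t = frac_int_left a \<alpha> r t;
       \<And>t. t \<in> {a..b} \<Longrightarrow> norm (r t) \<le> M * norm (\<delta> t) + \<epsilon>; t \<in> {a..b}\<rbrakk> \<Longrightarrow> norm (\<delta> t) \<le> K * \<epsilon>"
    using volterra_a_priori_bound[OF \<alpha> M ab] by metis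
  have "norm (q1 t - q2 t) \<le> K * 0"
  proof (rule K(2)[where r = "\<lambda>s. F s (q1 s) - F s (q2 s)"])
    fix s assume s: "s \<in> {a..b}"
    have "frac_int_left a \<alpha> (\<lambda>s. F s (q1 s) - F s (q2 s)) s
        = frac_int_left a \<alpha> (\<lambda>s. F s (q1 s)) s - frac_int_left a \<alpha> (\<lambda>s. F s (q2 s)) s"
      by (rule frac_int_left_diff[OF \<alpha>])
        (rule continuous_on_subset[OF cont[OF q1(1)]] continuous_on_subset[OF cont[OF q2(1)]]; use s in auto)+
    then show "q1 s - q2 s = frac_int_left a \<alpha> (\<lambda>s. F s (q1 s) - F s (q2 s)) s"
      using q1(2)[OF s] q2(2)[OF s] by simp
    show "norm (F s (q1 s) - F s (q2 s)) \<le> M * norm (q1 s - q2 s) + 0"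
      using Lip[OF s] by simp
  qed (use t q1(1) q2(1) cont in \<open>auto intro!: continuous_intros\<close>)
  then show ?thesis by simp
qed

lemma continuous_on_reflect_pair:
  fixes a b :: real
  assumes "continuous_on ({a..b} \<times> UNIV) (\<lambda>(t, x). F t x)"
  shows "continuous_on ({- b..- a} \<times> UNIV) (\<lambda>(t, x). F (- t) x)"
  unfolding case_prod_beta'
  by (rule continuous_on_compose2[OF assms, of _ "\<lambda>z. (- fst z, snd z)", simplified])
    (auto intro!: continuous_intros)

lemma volterra_right_exists:
  fixes F :: "real \<Rightarrow> 'a::euclidean_space \<Rightarrow> 'a"
  assumes \<alpha>: "0 < \<alpha>" and ab: "a \<le> b" and M: "0 \<le> M"
    and F: "continuous_on ({a..b} \<times> UNIV) (\<lambda>(t, x). F t x)"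
    and Lip: "\<And>t x y. t \<in> {a..b} \<Longrightarrow> norm (F t x - F t y) \<le> M * norm (x - y)"
  obtains p where "continuous_on {a..b} p"
    and "\<And>t. t \<in> {a..b} \<Longrightarrow> p t = B + frac_int_right b \<alpha> (\<lambda>s. F s (p s)) t"
proof -
  have "- b \<le> - a" using ab by simp
  obtain q where q: "continuous_on {- b..- a} q"
    "\<And>t. t \<in> {- b..- a} \<Longrightarrow> q t = B + frac_int_left (- b) \<alpha> (\<lambda>s. F (- s) (q s)) t"
    by (rule volterra_exists[OF \<alpha> \<open>- b \<le> - a\<close> M continuous_on_reflect_pair[OF F] Lip]) auto
  show ?thesis
  proof (rule that)
    show "continuous_on {a..b} (\<lambda>t. q (- t))"
      using continuous_on_reflect[OF q(1)] by simp
    show "q (- t) = B + frac_int_right b \<alpha> (\<lambda>s. F s (q (- s))) t" if "t \<in> {a..b}" for t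
      using q(2)[of "- t"] that by (simp add: frac_int_right_reflect)
  qed
qed

lemma volterra_right_unique:
  fixes F :: "real \<Rightarrow> 'a::euclidean_space \<Rightarrow> 'a"
  assumes \<alpha>: "0 < \<alpha>" and ab: "a \<le> b" and M: "0 \<le> M"
    and F: "continuous_on ({a..b} \<times> UNIV) (\<lambda>(t, x). F t x)"
    and Lip: "\<And>t x y. t \<in> {a..b} \<Longrightarrow> norm (F t x - F t y) \<le> M * norm (x - y)"
    and p1: "continuous_on {a..b} p1" "\<And>t. t \<in> {a..b} \<Longrightarrow> p1 t = B + frac_int_right b \<alpha> (\<lambda>s. F s (p1 s)) t"
    and p2: "continuous_on {a..b} p2" "\<And>t. t \<in> {a..b} \<Longrightarrow> p2 t = B + frac_int_right b \<alpha> (\<lambda>s. F s (p2 s)) t"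
    and t: "t \<in> {a..b}"
  shows "p1 t = p2 t"
proof -
  have eq: "p (- s) = B + frac_int_left (- b) \<alpha> (\<lambda>s. F (- s) (p (- s))) s"
    if "\<And>t. t \<in> {a..b} \<Longrightarrow> p t = B + frac_int_right b \<alpha> (\<lambda>s. F s (p s)) t" and "s \<in> {- b..- a}" for p s
    using that(1)[of "- s"] that(2) by (simp add: frac_int_right_reflect)
  have "p1 (- (- t)) = p2 (- (- t))"
    by (rule volterra_unique[where ?q1.0 = "\<lambda>s. p1 (- s)" and ?q2.0 = "\<lambda>s. p2 (- s)", OF \<alpha> _ M continuous_on_reflect_pair[OF F] Lip
        continuous_on_reflect[OF p1(1)] eq[OF p1(2)] continuous_on_reflect[OF p2(1)] eq[OF p2(2)]])
      (use ab t in auto)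
  then show ?thesis by simp
qed

section \<open>First-order calculus\<close>

lemma grad_inner:
  fixes F :: "'a::euclidean_space \<Rightarrow> real"
  assumes F: "(F has_derivative F') (at x)"
  shows "h \<bullet> grad F x = F' h"
proof -
  define D where "D = (\<Sum>i\<in>Basis. F' i *\<^sub>R i)"
  have lin: "linear F'" using has_derivative_linear[OF F] .
  have D: "k \<bullet> D = F' k" for k
  proof -
    have "F' k = F' (\<Sum>i\<in>Basis. (k \<bullet> i) *\<^sub>R i)" by (simp add: euclidean_representation)
    also have "\<dots> = (\<Sum>i\<in>Basis. (k \<bullet> i) * F' i)"
      by (simp add: linear_sum[OF lin] linear_cmul[OF lin])
    finally show ?thesis by (simp add: D_def inner_sum_right mult.commute)
  qed
  have "grad F x = D"
    unfolding grad_def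
  proof (rule the_equality)
    show "GDERIV F x :> D" using F D by (simp add: gderiv_def)
    fix D' assume "GDERIV F x :> D'"
    then have "(\<lambda>k. k \<bullet> D') = F'"
      unfolding gderiv_def by (rule has_derivative_unique[OF _ F])
    then have "k \<bullet> D' = k \<bullet> D" for k using D by metis
    then show "D' = D" by (metis vector_eq_ldot)
  qed
  then show ?thesis using D by simp
qed

lemma C2_on_imp_C1:
  assumes "C2_on S F"
  obtains F' where "\<And>z. z \<in> S \<Longrightarrow> (F has_derivative blinfun_apply (F' z)) (at z within S)" "continuous_on S F'"
proof -
  from assms obtain F' F'' where
    "\<forall>z\<in>S. (F has_derivative blinfun_apply (F' z)) (at z within S)"
    "\<forall>z\<in>S. (F' has_derivative blinfun_apply (F'' z)) (at z within S)"
    unfolding C2_on_def by blast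
  then show ?thesis
    by (intro that[of F']) (auto simp: continuous_on_eq_continuous_within intro: has_derivative_continuous)
qed

text \<open>The derivative is uniformly continuous on a compact neighbourhood of \<open>Z\<close> in \<open>S\<close>, and convexity of \<open>S\<close>
  allows the mean value inequality on the segment from \<open>z\<close> to \<open>w\<close>. The point is that \<open>\<rho>\<close> does not depend on
  \<open>z\<close>.\<close>

lemma uniform_linearization:
  fixes F :: "'a::euclidean_space \<Rightarrow> 'b::real_normed_vector" and F' :: "'a \<Rightarrow> 'a \<Rightarrow>\<^sub>L 'b"
  assumes F: "\<And>z. z \<in> S \<Longrightarrow> (F has_derivative blinfun_apply (F' z)) (at z within S)"
    and F': "continuous_on S F'" and S: "closed S" "convex S" and Z: "compact Z" "Z \<subseteq> S" and \<eta>: "0 < \<eta>"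
  obtains \<rho> where "0 < \<rho>"
    and "\<And>z w. \<lbrakk>z \<in> Z; w \<in> S; norm (w - z) < \<rho>\<rbrakk> \<Longrightarrow> norm (F w - F z - F' z (w - z)) \<le> \<eta> * norm (w - z)"
proof -
  obtain R where R: "\<And>z. z \<in> Z \<Longrightarrow> norm z \<le> R"
    using compact_imp_bounded[OF Z(1)] unfolding bounded_iff by blast
  define K where "K = S \<inter> cball 0 (R + 1)"
  have "compact K" unfolding K_def using S(1) by (intro closed_Int_compact) auto
  moreover have "continuous_on K F'" by (rule continuous_on_subset[OF F']) (auto simp: K_def)
  ultimately have "uniformly_continuous_on K F'" by (intro compact_uniformly_continuous)
  then obtain \<rho> where \<rho>: "0 < \<rho>" "\<And>x z. \<lbrakk>x \<in> K; z \<in> K; dist x z < \<rho>\<rbrakk> \<Longrightarrow> dist (F' x) (F' z) < \<eta>"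
    using \<eta> unfolding uniformly_continuous_on_def by metis
  show ?thesis
  proof (rule that[of "min 1 \<rho>"])
    fix z w assume z: "z \<in> Z" and w: "w \<in> S" and near: "norm (w - z) < min 1 \<rho>"
    define S' where "S' = S \<inter> ball z (min 1 \<rho>)"
    have zS': "z \<in> S'" and wS': "w \<in> S'"
      using z w near Z(2) \<rho>(1) by (auto simp: S'_def dist_norm norm_minus_commute)
    have S'K: "S' \<subseteq> K"
    proof
      fix x assume "x \<in> S'"
      then have "x \<in> S" "norm (x - z) < 1" by (auto simp: S'_def dist_norm norm_minus_commute)
      moreover have "norm x \<le> norm z + norm (x - z)" using norm_triangle_sub by blast
      ultimately show "x \<in> K" using R[OF z] by (auto simp: K_def)
    qed
    have "convex S'" unfolding S'_def by (intro convex_Int S(2) convex_ball)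
    have "norm (F w - F z - F' z (w - z)) \<le> norm (w - z) * \<eta>"
    proof (rule differentiable_bound_linearization[OF _ _ _ zS'])
      show "z + s *\<^sub>R (w - z) \<in> S'" if "s \<in> {0..1}" for s
        using convexD_alt[OF \<open>convex S'\<close> zS' wS', of s] that by (simp add: algebra_simps)
      show "(F has_derivative blinfun_apply (F' x)) (at x within S')" if "x \<in> S'" for x
        by (rule has_derivative_subset[OF F]) (use that in \<open>auto simp: S'_def\<close>)
      show "onorm (blinfun_apply (F' x) - blinfun_apply (F' z)) \<le> \<eta>" if "x \<in> S'" for x
      proof -
        have "dist x z < \<rho>" using that by (auto simp: S'_def dist_commute)
        then have "dist (F' x) (F' z) < \<eta>" using \<rho>(2) that zS' S'K by blast
        moreover have "blinfun_apply (F' x) - blinfun_apply (F' z) = blinfun_apply (F' x - F' z)"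
          by (auto simp: minus_blinfun.rep_eq)
        ultimately show ?thesis by (simp add: dist_norm norm_blinfun.rep_eq)
      qed
    qed
    then show "norm (F w - F z - F' z (w - z)) \<le> \<eta> * norm (w - z)" by (simp add: mult.commute)
  qed (use \<rho>(1) in auto)
qed

lemma norm_Pair_add_le: "norm (x, y) \<le> norm x + norm y"
  unfolding norm_Pair by (rule sqrt_sum_squares_le_sum) auto

section \<open>State and adjoint variables\<close>

text \<open>The total derivatives \<open>f'\<close> and \<open>L'\<close> are parameters, so that partial derivatives of \<open>f\<close>, \<open>L\<close> and \<open>H\<close>
  along a trajectory can be written without a choice. They are taken within the slab, hence one-sided in
  time at \<open>a\<close> and \<open>b\<close>.\<close>

locale control_problem =
  fixes a b \<alpha> M :: real and A :: "real^'d"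
    and f :: "real^'d \<Rightarrow> real^'m \<Rightarrow> real \<Rightarrow> real^'d"
    and L :: "real^'d \<Rightarrow> real^'m \<Rightarrow> real \<Rightarrow> real"
    and f' :: "(real^'d) \<times> (real^'m) \<times> real \<Rightarrow> ((real^'d) \<times> (real^'m) \<times> real) \<Rightarrow>\<^sub>L (real^'d)"
    and L' :: "(real^'d) \<times> (real^'m) \<times> real \<Rightarrow> ((real^'d) \<times> (real^'m) \<times> real) \<Rightarrow>\<^sub>L real"
  assumes ab: "a < b" and \<alpha>: "0 < \<alpha>" "\<alpha> \<le> 1" and M: "0 \<le> M"
    and f_deriv: "\<And>z. z \<in> UNIV \<times> UNIV \<times> {a..b} \<Longrightarrow>
      ((\<lambda>(x, v, t). f x v t) has_derivative blinfun_apply (f' z)) (at z within UNIV \<times> UNIV \<times> {a..b})"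
    and f'_cont: "continuous_on (UNIV \<times> UNIV \<times> {a..b}) f'"
    and L_deriv: "\<And>z. z \<in> UNIV \<times> UNIV \<times> {a..b} \<Longrightarrow>
      ((\<lambda>(x, v, t). L x v t) has_derivative blinfun_apply (L' z)) (at z within UNIV \<times> UNIV \<times> {a..b})"
    and L'_cont: "continuous_on (UNIV \<times> UNIV \<times> {a..b}) L'"
    and f_Lip: "\<And>x1 x2 v t. t \<in> {a..b} \<Longrightarrow> norm (f x1 v t - f x2 v t) \<le> M * norm (x1 - x2)"
begin

lemma f_cont: "continuous_on (UNIV \<times> UNIV \<times> {a..b}) (\<lambda>(x, v, t). f x v t)"
  by (rule has_derivative_continuous_on[OF f_deriv])

lemma L_cont: "continuous_on (UNIV \<times> UNIV \<times> {a..b}) (\<lambda>(x, v, t). L x v t)"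
  by (rule has_derivative_continuous_on[OF L_deriv])

text \<open>Moving \<open>x\<close> or \<open>v\<close> alone never leaves the slab, so the partial derivatives are two-sided even at the end
  points in time.\<close>

lemma partial_x:
  assumes G: "((\<lambda>(x, v, t). G x v t) has_derivative G') (at (x, v, t) within UNIV \<times> UNIV \<times> {a..b})"
    and t: "t \<in> {a..b}"
  shows "((\<lambda>\<xi>. G \<xi> v t) has_derivative (\<lambda>h. G' (h, 0, 0))) (at x)"
proof -
  have 1: "((\<lambda>(x, v, t). G x v t) has_derivative G') (at (x, v, t) within range (\<lambda>\<xi>. (\<xi>, v, t)))"
    by (rule has_derivative_subset[OF G]) (use t in auto)
  have 2: "((\<lambda>\<xi>. (\<xi>, v, t)) has_derivative (\<lambda>h. (h, 0, 0))) (at x)"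
    by (auto intro!: derivative_eq_intros simp: zero_prod_def)
  from has_derivative_in_compose[OF 2 1]
  have "((\<lambda>\<xi>. (\<lambda>(x, v, t). G x v t) (\<xi>, v, t)) has_derivative (\<lambda>h. G' (h, 0, 0))) (at x)"
    .
  then show ?thesis by (simp only: prod.case)
qed

lemma partial_v:
  assumes G: "((\<lambda>(x, v, t). G x v t) has_derivative G') (at (x, v, t) within UNIV \<times> UNIV \<times> {a..b})"
    and t: "t \<in> {a..b}"
  shows "((\<lambda>\<nu>. G x \<nu> t) has_derivative (\<lambda>h. G' (0, h, 0))) (at v)"
proof -
  have 1: "((\<lambda>(x, v, t). G x v t) has_derivative G') (at (x, v, t) within range (\<lambda>\<nu>. (x, \<nu>, t)))"
    by (rule has_derivative_subset[OF G]) (use t in auto)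
  have 2: "((\<lambda>\<nu>. (x, \<nu>, t)) has_derivative (\<lambda>h. (0, h, 0))) (at v)"
    by (auto intro!: derivative_eq_intros)
  from has_derivative_in_compose[OF 2 1]
  have "((\<lambda>\<nu>. (\<lambda>(x, v, t). G x v t) (x, \<nu>, t)) has_derivative (\<lambda>h. G' (0, h, 0))) (at v)"
    .
  then show ?thesis by (simp only: prod.case)
qed

text \<open>Gradients are described by their inner products with test vectors: this is the form in which the adjoint
  equation meets the linearization of \<open>f\<close> and \<open>L\<close>, and no transposed Jacobian has to be introduced.\<close>

lemma inner_dH_dx:
  assumes "t \<in> {a..b}"
  shows "h \<bullet> dH_dx L f x v w t = L' (x, v, t) (h, 0, 0) + w \<bullet> f' (x, v, t) (h, 0, 0)"
  unfolding dH_dx_def hamiltonian_def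
  by (rule grad_inner[where F' = "\<lambda>h. L' (x, v, t) (h, 0, 0) + w \<bullet> f' (x, v, t) (h, 0, 0)"])
    (use assms in \<open>intro has_derivative_add has_derivative_inner_right partial_x f_deriv L_deriv; auto\<close>)

lemma inner_dH_dv:
  assumes "t \<in> {a..b}"
  shows "h \<bullet> dH_dv L f x v w t = L' (x, v, t) (0, h, 0) + w \<bullet> f' (x, v, t) (0, h, 0)"
  unfolding dH_dv_def hamiltonian_def
  by (rule grad_inner[where F' = "\<lambda>h. L' (x, v, t) (0, h, 0) + w \<bullet> f' (x, v, t) (0, h, 0)"])
    (use assms in \<open>intro has_derivative_add has_derivative_inner_right partial_v f_deriv L_deriv; auto\<close>)

lemma dH_dw_eq: "dH_dw L f x v w t = f x v t"
proof -
  have "h \<bullet> dH_dw L f x v w t = h \<bullet> f x v t" for h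
    unfolding dH_dw_def hamiltonian_def
    by (rule grad_inner) (auto intro!: derivative_eq_intros)
  then show ?thesis by (metis vector_eq_ldot)
qed

lemma continuous_along:
  assumes "continuous_on (UNIV \<times> UNIV \<times> {a..b}) G"
    and "continuous_on S x" "continuous_on S v" "continuous_on S t" "\<And>s. s \<in> S \<Longrightarrow> t s \<in> {a..b}"
  shows "continuous_on S (\<lambda>s. G (x s, v s, t s))"
  by (rule continuous_on_compose2[OF assms(1), of _ "\<lambda>s. (x s, v s, t s)"])
    (use assms in \<open>auto intro!: continuous_intros\<close>)

lemma continuous_dH_dx:
  fixes S :: "'s::t2_space set"
  assumes "continuous_on S x" "continuous_on S v" "continuous_on S w" "continuous_on S t" "\<And>s. s \<in> S \<Longrightarrow> t s \<in> {a..b}"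
  shows "continuous_on S (\<lambda>s. dH_dx L f (x s) (v s) (w s) (t s))"
proof (subst continuous_on_componentwise, rule ballI)
  fix i :: "real^'d" assume "i \<in> Basis"
  have "continuous_on S (\<lambda>s. L' (x s, v s, t s) (i, 0, 0) + w s \<bullet> f' (x s, v s, t s) (i, 0, 0))"
    by (intro continuous_intros continuous_along[OF L'_cont] continuous_along[OF f'_cont] assms)
  then show "continuous_on S (\<lambda>s. dH_dx L f (x s) (v s) (w s) (t s) \<bullet> i)"
    by (rule continuous_on_eq) (simp add: inner_dH_dx[OF assms(5), symmetric] inner_commute)
qed

lemma continuous_dH_dv:
  fixes S :: "'s::t2_space set"
  assumes "continuous_on S x" "continuous_on S v" "continuous_on S w" "continuous_on S t" "\<And>s. s \<in> S \<Longrightarrow> t s \<in> {a..b}"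
  shows "continuous_on S (\<lambda>s. dH_dv L f (x s) (v s) (w s) (t s))"
proof (subst continuous_on_componentwise, rule ballI)
  fix i :: "real^'m" assume "i \<in> Basis"
  have "continuous_on S (\<lambda>s. L' (x s, v s, t s) (0, i, 0) + w s \<bullet> f' (x s, v s, t s) (0, i, 0))"
    by (intro continuous_intros continuous_along[OF L'_cont] continuous_along[OF f'_cont] assms)
  then show "continuous_on S (\<lambda>s. dH_dv L f (x s) (v s) (w s) (t s) \<bullet> i)"
    by (rule continuous_on_eq) (simp add: inner_dH_dv[OF assms(5), symmetric] inner_commute)
qed

lemma is_state_iff:
  assumes u: "continuous_on {a..b} u"
  shows "is_state a b \<alpha> A f u q \<longleftrightarrow> continuous_on {a..b} q \<and>
    (\<forall>t\<in>{a..b}. q t = A + frac_int_left a \<alpha> (\<lambda>s. f (q s) (u s) s) t)"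
proof -
  have g: "continuous_on {a..b} (\<lambda>s. f (q s) (u s) s)" if "continuous_on {a..b} q"
    using continuous_along[OF f_cont that u continuous_on_id] by simp
  show ?thesis
  proof
    assume st: "is_state a b \<alpha> A f u q"
    then have q: "continuous_on {a..b} q" unfolding is_state_def by (blast intro: Ck_on_imp_continuous_on)
    then show "continuous_on {a..b} q \<and> (\<forall>t\<in>{a..b}. q t = A + frac_int_left a \<alpha> (\<lambda>s. f (q s) (u s) s) t)"
      using st caputo_left_iff_volterra[OF ab \<alpha> q g[OF q]] by (simp add: is_state_def)
  next
    assume V: "continuous_on {a..b} q \<and> (\<forall>t\<in>{a..b}. q t = A + frac_int_left a \<alpha> (\<lambda>s. f (q s) (u s) s) t)"
    then have q: "continuous_on {a..b} q" by simp
    have "q a = A" using V ab frac_int_left_base[OF \<alpha>(1), of a] by auto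
    moreover have "Ck_on (nat \<lfloor>\<alpha>\<rfloor>) {a..b} q"
      by (rule frac_int_left_solution_Ck[OF \<alpha> g[OF q]]) (use V in auto)
    ultimately show "is_state a b \<alpha> A f u q"
      using V caputo_left_iff_volterra[OF ab \<alpha> q g[OF q]] by (simp add: is_state_def)
  qed
qed

lemma state_equation_cont:
  assumes u: "continuous_on {a..b} u"
  shows "continuous_on ({a..b} \<times> UNIV) (\<lambda>(t, x). f x (u t) t)"
proof -
  have "continuous_on ({a..b} \<times> UNIV) (\<lambda>z. (\<lambda>(x, v, t). f x v t) (snd z, u (fst z), fst z))"
    by (rule continuous_along[OF f_cont])
      (auto intro!: continuous_intros continuous_on_compose2[OF u])
  then show ?thesis by (simp add: case_prod_beta')
qed

lemma state_unique:
  assumes u: "continuous_on {a..b} u" and "is_state a b \<alpha> A f u q1" "is_state a b \<alpha> A f u q2" and t: "t \<in> {a..b}"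
  shows "q1 t = q2 t"
  by (rule volterra_unique[OF \<alpha>(1) _ M state_equation_cont[OF u] f_Lip])
    (use assms ab in \<open>auto simp: is_state_iff[OF u]\<close>)

text \<open>Restricting a solution to \<open>{a..b}\<close> turns uniqueness on the interval into uniqueness as a function,
  as the definite description in \<open>state\<close> demands.\<close>

lemma is_state_state:
  assumes u: "continuous_on {a..b} u"
  shows "is_state a b \<alpha> A f u (state a b \<alpha> A f u)"
proof -
  obtain q where q: "continuous_on {a..b} q"
    "\<And>t. t \<in> {a..b} \<Longrightarrow> q t = A + frac_int_left a \<alpha> (\<lambda>s. f (q s) (u s) s) t"
    by (rule volterra_exists[OF \<alpha>(1) less_imp_le[OF ab] M state_equation_cont[OF u] f_Lip]) auto
  define q0 where "q0 = restrict q {a..b}"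
  have "continuous_on {a..b} q0" by (rule continuous_on_eq[OF q(1)]) (simp add: q0_def)
  moreover have "q0 t = A + frac_int_left a \<alpha> (\<lambda>s. f (q0 s) (u s) s) t" if t: "t \<in> {a..b}" for t
  proof -
    have "frac_int_left a \<alpha> (\<lambda>s. f (q s) (u s) s) t = frac_int_left a \<alpha> (\<lambda>s. f (q0 s) (u s) s) t"
      by (rule frac_int_left_cong) (use t in \<open>auto simp: q0_def\<close>)
    then show ?thesis using q(2)[OF t] t by (simp add: q0_def)
  qed
  ultimately have "is_state a b \<alpha> A f u q0" by (simp add: is_state_iff[OF u])
  then have "q0 \<in> extensional {a..b} \<and> is_state a b \<alpha> A f u q0" by (simp add: q0_def)
  moreover have "q1 = q0" if "q1 \<in> extensional {a..b} \<and> is_state a b \<alpha> A f u q1" for q1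
    by (rule extensionalityI[of _ "{a..b}"])
      (use that calculation state_unique[OF u] in auto)
  ultimately have "state a b \<alpha> A f u \<in> extensional {a..b} \<and> is_state a b \<alpha> A f u (state a b \<alpha> A f u)"
    unfolding state_def by (rule theI)
  then show ?thesis by simp
qed

lemma state_props:
  assumes u: "continuous_on {a..b} u"
  shows "continuous_on {a..b} (state a b \<alpha> A f u)"
    and "\<And>t. t \<in> {a..b} \<Longrightarrow> state a b \<alpha> A f u t = A + frac_int_left a \<alpha> (\<lambda>s. f (state a b \<alpha> A f u s) (u s) s) t"
  using is_state_state[OF u] by (auto simp: is_state_iff[OF u])

lemma is_adjoint_iff:
  assumes u: "continuous_on {a..b} u"
  shows "is_adjoint a b \<alpha> A L f u p \<longleftrightarrow> continuous_on {a..b} p \<and>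
    (\<forall>t\<in>{a..b}. p t = 0 + frac_int_right b \<alpha> (\<lambda>s. dH_dx L f (state a b \<alpha> A f u s) (u s) (p s) s) t)"
proof -
  have g: "continuous_on {a..b} (\<lambda>s. dH_dx L f (state a b \<alpha> A f u s) (u s) (p s) s)" if "continuous_on {a..b} p"
    by (rule continuous_dH_dx[OF state_props(1)[OF u] u that continuous_on_id])
  show ?thesis
  proof
    assume ad: "is_adjoint a b \<alpha> A L f u p"
    then have p: "continuous_on {a..b} p" unfolding is_adjoint_def by (blast intro: Ck_on_imp_continuous_on)
    then show "continuous_on {a..b} p \<and>
        (\<forall>t\<in>{a..b}. p t = 0 + frac_int_right b \<alpha> (\<lambda>s. dH_dx L f (state a b \<alpha> A f u s) (u s) (p s) s) t)"
      using ad caputo_right_iff_volterra[OF ab \<alpha> p g[OF p]] by (simp add: is_adjoint_def)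
  next
    assume V: "continuous_on {a..b} p \<and>
      (\<forall>t\<in>{a..b}. p t = 0 + frac_int_right b \<alpha> (\<lambda>s. dH_dx L f (state a b \<alpha> A f u s) (u s) (p s) s) t)"
    then have p: "continuous_on {a..b} p" by simp
    have "p b = 0"
      using bspec[OF conjunct2[OF V], of b] ab \<alpha> by (simp add: frac_int_right_reflect frac_int_left_base)
    moreover have "Ck_on (nat \<lfloor>\<alpha>\<rfloor>) {a..b} p"
      by (rule frac_int_right_solution_Ck[OF \<alpha> g[OF p]]) (use V in auto)
    ultimately show "is_adjoint a b \<alpha> A L f u p"
      using V caputo_right_iff_volterra[OF ab \<alpha> p g[OF p]] by (simp add: is_adjoint_def)
  qed
qed

lemma f'_bounded_along:
  assumes q: "continuous_on {a..b} q" and u: "continuous_on {a..b} u"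
  obtains B where "0 \<le> B" and "\<And>t. t \<in> {a..b} \<Longrightarrow> norm (f' (q t, u t, t)) \<le> B"
proof -
  have "continuous_on {a..b} (\<lambda>t. f' (q t, u t, t))"
    using continuous_along[OF f'_cont q u continuous_on_id] by simp
  then have "bounded ((\<lambda>t. f' (q t, u t, t)) ` {a..b})"
    by (intro compact_imp_bounded compact_continuous_image) auto
  then obtain B where "\<And>t. t \<in> {a..b} \<Longrightarrow> norm (f' (q t, u t, t)) \<le> B"
    unfolding bounded_iff by blast
  then show ?thesis using that[of "\<bar>B\<bar>"] by force
qed

lemma dH_dx_Lipschitz:
  assumes t: "t \<in> {a..b}" and B: "norm (f' (x, v, t)) \<le> B"
  shows "norm (dH_dx L f x v w1 t - dH_dx L f x v w2 t) \<le> B * norm (w1 - w2)"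
proof -
  define D where "D = dH_dx L f x v w1 t - dH_dx L f x v w2 t"
  have "D \<bullet> D = (w1 - w2) \<bullet> f' (x, v, t) (D, 0, 0)"
    using inner_dH_dx[OF t, of D x v w1] inner_dH_dx[OF t, of D x v w2]
    by (simp add: D_def inner_diff_right inner_diff_left)
  also have "\<dots> \<le> norm (w1 - w2) * norm (f' (x, v, t) (D, 0, 0))"
    by (rule norm_cauchy_schwarz)
  also have "\<dots> \<le> norm (w1 - w2) * (B * norm D)"
  proof (rule mult_left_mono)
    have "norm (f' (x, v, t) (D, 0, 0)) \<le> norm (f' (x, v, t)) * norm (D, 0::real^'m, 0::real)"
      by (rule norm_blinfun)
    also have "\<dots> \<le> B * norm D"
      using B by (simp add: norm_Pair mult_right_mono)
    finally show "norm (f' (x, v, t) (D, 0, 0)) \<le> B * norm D" .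
  qed simp
  finally have "norm D * norm D \<le> (B * norm (w1 - w2)) * norm D"
    by (simp add: power2_norm_eq_inner[symmetric] power2_eq_square mult_ac)
  moreover have "0 \<le> B" using B norm_ge_zero order_trans by blast
  ultimately have "norm D \<le> B * norm (w1 - w2)"
    by (cases "norm D = 0") (simp_all add: mult_le_cancel_right)
  then show ?thesis by (simp add: D_def)
qed

lemma adjoint_equation:
  assumes u: "continuous_on {a..b} u"
  shows "continuous_on ({a..b} \<times> UNIV) (\<lambda>(t, w). dH_dx L f (state a b \<alpha> A f u t) (u t) w t)"
    and "\<exists>B\<ge>0. \<forall>t\<in>{a..b}. \<forall>w1 w2.
      norm (dH_dx L f (state a b \<alpha> A f u t) (u t) w1 t - dH_dx L f (state a b \<alpha> A f u t) (u t) w2 t) \<le> B * norm (w1 - w2)"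
proof -
  note q = state_props(1)[OF u]
  obtain B where B: "0 \<le> B" "\<And>t. t \<in> {a..b} \<Longrightarrow> norm (f' (state a b \<alpha> A f u t, u t, t)) \<le> B"
    using f'_bounded_along[OF q u] by metis
  show "continuous_on ({a..b} \<times> UNIV) (\<lambda>(t, w). dH_dx L f (state a b \<alpha> A f u t) (u t) w t)"
    unfolding case_prod_beta'
    by (rule continuous_dH_dx)
      (auto intro!: continuous_intros continuous_on_compose2[OF q] continuous_on_compose2[OF u])
  show "\<exists>B\<ge>0. \<forall>t\<in>{a..b}. \<forall>w1 w2.
      norm (dH_dx L f (state a b \<alpha> A f u t) (u t) w1 t - dH_dx L f (state a b \<alpha> A f u t) (u t) w2 t) \<le> B * norm (w1 - w2)"
    using dH_dx_Lipschitz B by blast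
qed

lemma adjoint_unique:
  assumes u: "continuous_on {a..b} u" and "is_adjoint a b \<alpha> A L f u p1" "is_adjoint a b \<alpha> A L f u p2" and t: "t \<in> {a..b}"
  shows "p1 t = p2 t"
proof -
  obtain B where B: "0 \<le> B" "\<And>t w1 w2. t \<in> {a..b} \<Longrightarrow>
      norm (dH_dx L f (state a b \<alpha> A f u t) (u t) w1 t - dH_dx L f (state a b \<alpha> A f u t) (u t) w2 t) \<le> B * norm (w1 - w2)"
    using adjoint_equation(2)[OF u] by blast
  show ?thesis
    by (rule volterra_right_unique[OF \<alpha>(1) less_imp_le[OF ab] B(1) adjoint_equation(1)[OF u] B(2)])
      (use assms in \<open>auto simp: is_adjoint_iff[OF u]\<close>)
qed

lemma is_adjoint_adjoint_var:
  assumes u: "continuous_on {a..b} u"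
  shows "is_adjoint a b \<alpha> A L f u (adjoint_var a b \<alpha> A L f u)"
proof -
  obtain B where B: "0 \<le> B" "\<And>t w1 w2. t \<in> {a..b} \<Longrightarrow>
      norm (dH_dx L f (state a b \<alpha> A f u t) (u t) w1 t - dH_dx L f (state a b \<alpha> A f u t) (u t) w2 t) \<le> B * norm (w1 - w2)"
    using adjoint_equation(2)[OF u] by blast
  obtain p where p: "continuous_on {a..b} p"
    "\<And>t. t \<in> {a..b} \<Longrightarrow> p t = 0 + frac_int_right b \<alpha> (\<lambda>s. dH_dx L f (state a b \<alpha> A f u s) (u s) (p s) s) t"
    by (rule volterra_right_exists[where B = 0, OF \<alpha>(1) less_imp_le[OF ab] B(1) adjoint_equation(1)[OF u] B(2)]) auto
  define p0 where "p0 = restrict p {a..b}"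
  have "continuous_on {a..b} p0" by (rule continuous_on_eq[OF p(1)]) (simp add: p0_def)
  moreover have "p0 t = 0 + frac_int_right b \<alpha> (\<lambda>s. dH_dx L f (state a b \<alpha> A f u s) (u s) (p0 s) s) t" if t: "t \<in> {a..b}" for t
  proof -
    have "frac_int_right b \<alpha> (\<lambda>s. dH_dx L f (state a b \<alpha> A f u s) (u s) (p s) s) t
        = frac_int_right b \<alpha> (\<lambda>s. dH_dx L f (state a b \<alpha> A f u s) (u s) (p0 s) s) t"
      unfolding frac_int_right_reflect by (rule frac_int_left_cong) (use t in \<open>auto simp: p0_def\<close>)
    then show ?thesis using p(2)[OF t] t by (simp add: p0_def)
  qed
  ultimately have "is_adjoint a b \<alpha> A L f u p0" by (simp add: is_adjoint_iff[OF u])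
  then have "p0 \<in> extensional {a..b} \<and> is_adjoint a b \<alpha> A L f u p0" by (simp add: p0_def)
  moreover have "p1 = p0" if "p1 \<in> extensional {a..b} \<and> is_adjoint a b \<alpha> A L f u p1" for p1
    by (rule extensionalityI[of _ "{a..b}"])
      (use that calculation adjoint_unique[OF u] in auto)
  ultimately have "adjoint_var a b \<alpha> A L f u \<in> extensional {a..b} \<and> is_adjoint a b \<alpha> A L f u (adjoint_var a b \<alpha> A L f u)"
    unfolding adjoint_var_def by (rule theI)
  then show ?thesis by simp
qed

lemma adjoint_props:
  assumes u: "continuous_on {a..b} u"
  shows "continuous_on {a..b} (adjoint_var a b \<alpha> A L f u)"
    and "\<And>t. t \<in> {a..b} \<Longrightarrow> adjoint_var a b \<alpha> A L f u t =
      frac_int_right b \<alpha> (\<lambda>s. dH_dx L f (state a b \<alpha> A f u s) (u s) (adjoint_var a b \<alpha> A L f u s) s) t"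
  using is_adjoint_adjoint_var[OF u] by (auto simp: is_adjoint_iff[OF u])

section \<open>Variation of the cost\<close>

lemma linearize_along:
  fixes F' :: "(real^'d) \<times> (real^'m) \<times> real \<Rightarrow> ((real^'d) \<times> (real^'m) \<times> real) \<Rightarrow>\<^sub>L 'c::real_normed_vector"
  assumes F: "\<And>z. z \<in> UNIV \<times> UNIV \<times> {a..b} \<Longrightarrow>
      (F has_derivative blinfun_apply (F' z)) (at z within UNIV \<times> UNIV \<times> {a..b})"
    and F': "continuous_on (UNIV \<times> UNIV \<times> {a..b}) F'"
    and q: "continuous_on {a..b} q" and u: "continuous_on {a..b} u" and \<eta>: "0 < \<eta>"
  obtains \<rho> where "0 < \<rho>"
    and "\<And>t x v. \<lbrakk>t \<in> {a..b}; norm (x, v) < \<rho>\<rbrakk> \<Longrightarrow>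
      norm (F (q t + x, u t + v, t) - F (q t, u t, t) - F' (q t, u t, t) (x, v, 0)) \<le> \<eta> * norm (x, v)"
proof -
  have "closed (UNIV \<times> UNIV \<times> {a..b} :: ((real^'d) \<times> (real^'m) \<times> real) set)"
    by (intro closed_Times) auto
  moreover have "convex (UNIV \<times> UNIV \<times> {a..b} :: ((real^'d) \<times> (real^'m) \<times> real) set)"
    by (intro convex_Times) auto
  moreover have "compact ((\<lambda>t. (q t, u t, t)) ` {a..b})"
    by (intro compact_continuous_image continuous_intros q u) auto
  ultimately obtain \<rho> where \<rho>: "0 < \<rho>"
    "\<And>z w. \<lbrakk>z \<in> (\<lambda>t. (q t, u t, t)) ` {a..b}; w \<in> UNIV \<times> UNIV \<times> {a..b}; norm (w - z) < \<rho>\<rbrakk> \<Longrightarrow>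
      norm (F w - F z - F' z (w - z)) \<le> \<eta> * norm (w - z)"
    using uniform_linearization[OF F F' _ _ _ _ \<eta>, of "(\<lambda>t. (q t, u t, t)) ` {a..b}"] by auto
  show ?thesis
  proof (rule that[OF \<rho>(1)])
    fix t :: real and x :: "real^'d" and v :: "real^'m"
    assume t: "t \<in> {a..b}" and small: "norm (x, v) < \<rho>"
    have diff: "(q t + x, u t + v, t) - (q t, u t, t) = (x, v, 0)" by simp
    have norm: "norm (x, v, 0::real) = norm (x, v)" by (simp add: norm_Pair)
    show "norm (F (q t + x, u t + v, t) - F (q t, u t, t) - F' (q t, u t, t) (x, v, 0)) \<le> \<eta> * norm (x, v)"
      using \<rho>(2)[of "(q t, u t, t)" "(q t + x, u t + v, t)"] t small unfolding diff norm by blast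
  qed
qed

text \<open>The increment of \<open>f\<close> splits into a change of state, controlled by the Lipschitz constant \<open>M\<close>, and a change of control
  along the fixed trajectory, controlled by the linearization of \<open>f\<close>; the a priori bound applies. The
  linearization is used here with accuracy \<open>1\<close>, merely as a local Lipschitz estimate in the control.\<close>

lemma state_perturbation:
  assumes u: "continuous_on {a..b} u" and h: "continuous_on {a..b} h"
  obtains C \<rho> where "0 < C" "0 < \<rho>"
    and "\<And>\<epsilon> t. \<lbrakk>\<bar>\<epsilon>\<bar> < \<rho>; t \<in> {a..b}\<rbrakk> \<Longrightarrow>
      norm (state a b \<alpha> A f (\<lambda>t. u t + \<epsilon> *\<^sub>R h t) t - state a b \<alpha> A f u t, \<epsilon> *\<^sub>R h t) \<le> C * \<bar>\<epsilon>\<bar>"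
proof -
  define q where "q = state a b \<alpha> A f u"
  note q = state_props[OF u, folded q_def]
  obtain B where B: "0 \<le> B" "\<And>t. t \<in> {a..b} \<Longrightarrow> norm (f' (q t, u t, t)) \<le> B"
    using f'_bounded_along[OF q(1) u] by metis
  have "bounded (h ` {a..b})"
    by (intro compact_imp_bounded compact_continuous_image h) auto
  then obtain D where D: "0 < D" "\<And>t. t \<in> {a..b} \<Longrightarrow> norm (h t) \<le> D"
    unfolding bounded_pos by blast
  obtain \<rho> where \<rho>: "0 < \<rho>"
    "\<And>t x v. \<lbrakk>t \<in> {a..b}; norm (x, v) < \<rho>\<rbrakk> \<Longrightarrow>
      norm ((\<lambda>(x, v, t). f x v t) (q t + x, u t + v, t) - (\<lambda>(x, v, t). f x v t) (q t, u t, t) - f' (q t, u t, t) (x, v, 0)) \<le> 1 * norm (x, v)"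
    using linearize_along[OF f_deriv f'_cont q(1) u zero_less_one] by metis
  obtain K where K: "0 < K"
    "\<And>(\<delta> :: real \<Rightarrow> real^'d) r \<epsilon> t. \<lbrakk>continuous_on {a..b} \<delta>; continuous_on {a..b} r; 0 \<le> \<epsilon>;
       \<And>t. t \<in> {a..b} \<Longrightarrow> \<delta> t = frac_int_left a \<alpha> r t;
       \<And>t. t \<in> {a..b} \<Longrightarrow> norm (r t) \<le> M * norm (\<delta> t) + \<epsilon>; t \<in> {a..b}\<rbrakk> \<Longrightarrow> norm (\<delta> t) \<le> K * \<epsilon>"
    using volterra_a_priori_bound[OF \<alpha>(1) M less_imp_le[OF ab]] by metis
  show ?thesis
  proof (rule that[of "K * ((B + 1) * D) + D" "\<rho> / D"])
    show "0 < K * ((B + 1) * D) + D" using K(1) B(1) D(1) by (intro add_nonneg_pos) auto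
    show "0 < \<rho> / D" using \<rho>(1) D(1) by simp
    fix \<epsilon> t :: real
    assume \<epsilon>: "\<bar>\<epsilon>\<bar> < \<rho> / D" and t: "t \<in> {a..b}"
    define u1 where "u1 t = u t + \<epsilon> *\<^sub>R h t" for t
    have u1: "continuous_on {a..b} u1" unfolding u1_def[abs_def] by (intro continuous_intros u h)
    define q1 where "q1 = state a b \<alpha> A f u1"
    note q1 = state_props[OF u1, folded q1_def]
    have f_along: "continuous_on {a..b} (\<lambda>s. f (x s) (v s) s)" if "continuous_on {a..b} x" "continuous_on {a..b} v" for x v
      using continuous_along[OF f_cont that continuous_on_id] by simp
    have sub: "continuous_on {a..s} k" if "continuous_on {a..b} k" "s \<in> {a..b}" for s and k :: "real \<Rightarrow> real^'d"
      by (rule continuous_on_subset[OF that(1)]) (use that(2) in auto)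
    have "norm (q1 t - q t) \<le> K * ((B + 1) * (D * \<bar>\<epsilon>\<bar>))"
    proof (rule K(2)[where r = "\<lambda>s. f (q1 s) (u1 s) s - f (q s) (u s) s"])
      fix s assume s: "s \<in> {a..b}"
      show "q1 s - q s = frac_int_left a \<alpha> (\<lambda>s. f (q1 s) (u1 s) s - f (q s) (u s) s) s"
        using q1(2)[OF s] q(2)[OF s]
          frac_int_left_diff[OF \<alpha>(1) sub[OF f_along[OF q1(1) u1] s] sub[OF f_along[OF q(1) u] s]] by simp
      have small: "norm (0::real^'d, \<epsilon> *\<^sub>R h s) \<le> D * \<bar>\<epsilon>\<bar>"
        using D(2)[OF s] by (simp add: norm_Pair mult.commute[of D] mult_left_mono)
      also have "\<dots> < \<rho>" using \<epsilon> D(1) by (simp add: field_simps)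
      finally have "norm (f (q s) (u1 s) s - f (q s) (u s) s - f' (q s, u s, s) (0, \<epsilon> *\<^sub>R h s, 0)) \<le> D * \<bar>\<epsilon>\<bar>"
        using \<rho>(2)[OF s, of 0 "\<epsilon> *\<^sub>R h s"] small by (simp add: u1_def)
      moreover have "norm (f' (q s, u s, s) (0, \<epsilon> *\<^sub>R h s, 0)) \<le> B * (D * \<bar>\<epsilon>\<bar>)"
      proof -
        have "norm (f' (q s, u s, s) (0, \<epsilon> *\<^sub>R h s, 0)) \<le> norm (f' (q s, u s, s)) * norm (0::real^'d, \<epsilon> *\<^sub>R h s, 0::real)"
          by (rule norm_blinfun)
        also have "\<dots> \<le> B * (D * \<bar>\<epsilon>\<bar>)"
          using B(1) B(2)[OF s] small by (intro mult_mono) (simp_all add: norm_Pair)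
        finally show ?thesis .
      qed
      ultimately have "norm (f (q s) (u1 s) s - f (q s) (u s) s) \<le> D * \<bar>\<epsilon>\<bar> + B * (D * \<bar>\<epsilon>\<bar>)"
        using norm_triangle_sub[of "f (q s) (u1 s) s - f (q s) (u s) s" "f' (q s, u s, s) (0, \<epsilon> *\<^sub>R h s, 0)"] by linarith
      moreover have "norm (f (q1 s) (u1 s) s - f (q s) (u1 s) s) \<le> M * norm (q1 s - q s)"
        by (rule f_Lip[OF s])
      moreover have "norm (f (q1 s) (u1 s) s - f (q s) (u s) s)
          \<le> norm (f (q1 s) (u1 s) s - f (q s) (u1 s) s) + norm (f (q s) (u1 s) s - f (q s) (u s) s)"
        using norm_triangle_ineq[of "f (q1 s) (u1 s) s - f (q s) (u1 s) s" "f (q s) (u1 s) s - f (q s) (u s) s"] by simp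
      ultimately show "norm (f (q1 s) (u1 s) s - f (q s) (u s) s) \<le> M * norm (q1 s - q s) + (B + 1) * (D * \<bar>\<epsilon>\<bar>)"
        by (simp add: algebra_simps)
    qed (use t D(1) B(1) in \<open>auto intro!: continuous_intros q(1) q1(1) f_along u u1\<close>)
    moreover have "norm (\<epsilon> *\<^sub>R h t) \<le> D * \<bar>\<epsilon>\<bar>"
      using D(2)[OF t] by (simp add: mult.commute[of D] mult_left_mono)
    ultimately have "norm (q1 t - q t, \<epsilon> *\<^sub>R h t) \<le> (K * ((B + 1) * D) + D) * \<bar>\<epsilon>\<bar>"
      using norm_Pair_add_le[of "q1 t - q t" "\<epsilon> *\<^sub>R h t"] by (simp add: algebra_simps)
    then show "norm (state a b \<alpha> A f (\<lambda>t. u t + \<epsilon> *\<^sub>R h t) t - state a b \<alpha> A f u t, \<epsilon> *\<^sub>R h t) \<le> (K * ((B + 1) * D) + D) * \<bar>\<epsilon>\<bar>"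
      by (simp add: q1_def q_def u1_def[abs_def])
  qed
qed

text \<open>An exact identity: \<open>R\<close> collects the first-order Taylor remainders of \<open>L\<close> and of \<open>p \<bullet> f\<close>. Pointwise the
  increment of \<open>L\<close> equals \<open>\<partial>H/\<partial>x \<bullet> \<delta> - p \<bullet> r + \<epsilon> (h \<bullet> \<partial>H/\<partial>v) + R\<close>, where \<open>\<delta> = q1 - q\<close> is the left
  fractional integral of the increment \<open>r\<close> of \<open>f\<close>; the first two terms have the same integral by integration by
  parts and the adjoint equation.\<close>

lemma cost_difference:
  fixes \<epsilon> :: real
  assumes u: "continuous_on {a..b} u" and h: "continuous_on {a..b} h"
  defines "q \<equiv> state a b \<alpha> A f u" and "p \<equiv> adjoint_var a b \<alpha> A L f u"
    and "q1 \<equiv> state a b \<alpha> A f (\<lambda>t. u t + \<epsilon> *\<^sub>R h t)"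
  defines "R \<equiv> \<lambda>t. L (q1 t) (u t + \<epsilon> *\<^sub>R h t) t - L (q t) (u t) t - L' (q t, u t, t) (q1 t - q t, \<epsilon> *\<^sub>R h t, 0)
      + p t \<bullet> (f (q1 t) (u t + \<epsilon> *\<^sub>R h t) t - f (q t) (u t) t - f' (q t, u t, t) (q1 t - q t, \<epsilon> *\<^sub>R h t, 0))"
  shows "continuous_on {a..b} R"
    and "cost a b \<alpha> A L f (\<lambda>t. u t + \<epsilon> *\<^sub>R h t) - cost a b \<alpha> A L f u
      = \<epsilon> * integral {a..b} (\<lambda>t. h t \<bullet> dH_dv L f (q t) (u t) (p t) t) + integral {a..b} R"
proof -
  define u1 where "u1 t = u t + \<epsilon> *\<^sub>R h t" for t
  have u1: "continuous_on {a..b} u1" unfolding u1_def[abs_def] by (intro continuous_intros u h)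
  have q1_eq: "q1 = state a b \<alpha> A f u1" by (simp add: q1_def u1_def[abs_def])
  note q = state_props[OF u, folded q_def] and q1 = state_props[OF u1, folded q1_eq]
    and p = adjoint_props[OF u, folded p_def q_def]
  have f_along: "continuous_on {a..b} (\<lambda>s. f (x s) (v s) s)" if "continuous_on {a..b} x" "continuous_on {a..b} v" for x v
    using continuous_along[OF f_cont that continuous_on_id] by simp
  have L_along: "continuous_on {a..b} (\<lambda>s. L (x s) (v s) s)" if "continuous_on {a..b} x" "continuous_on {a..b} v" for x v
    using continuous_along[OF L_cont that continuous_on_id] by simp
  have sub: "continuous_on {a..s} k" if "continuous_on {a..b} k" "s \<in> {a..b}" for s and k :: "real \<Rightarrow> real^'d"
    by (rule continuous_on_subset[OF that(1)]) (use that(2) in auto)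
  have f'_along: "continuous_on {a..b} (\<lambda>t. f' (q t, u t, t))"
    using continuous_along[OF f'_cont q(1) u continuous_on_id] by simp
  have L'_along: "continuous_on {a..b} (\<lambda>t. L' (q t, u t, t))"
    using continuous_along[OF L'_cont q(1) u continuous_on_id] by simp
  define r where "r t = f (q1 t) (u1 t) t - f (q t) (u t) t" for t
  have r: "continuous_on {a..b} r"
    unfolding r_def[abs_def] by (intro continuous_intros f_along q(1) q1(1) u u1)
  define g where "g t = dH_dx L f (q t) (u t) (p t) t" for t
  have g: "continuous_on {a..b} g"
    unfolding g_def[abs_def] by (rule continuous_dH_dx[OF q(1) u p(1) continuous_on_id])
  define k where "k t = h t \<bullet> dH_dv L f (q t) (u t) (p t) t" for t
  have k: "continuous_on {a..b} k"
    unfolding k_def[abs_def] by (intro continuous_intros h continuous_dH_dv q(1) u p(1))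
  have \<delta>: "q1 t - q t = frac_int_left a \<alpha> r t" if t: "t \<in> {a..b}" for t
    using q1(2)[OF t] q(2)[OF t]
      frac_int_left_diff[OF \<alpha>(1) sub[OF f_along[OF q1(1) u1] t] sub[OF f_along[OF q(1) u] t]]
    by (simp add: r_def[abs_def])
  show R: "continuous_on {a..b} R"
    unfolding R_def u1_def[symmetric]
    by (intro continuous_intros L_along f_along L'_along f'_along p(1) q(1) q1(1) u u1 h)
  have "L (q1 t) (u1 t) t - L (q t) (u t) t = g t \<bullet> (q1 t - q t) - p t \<bullet> r t + \<epsilon> * k t + R t"
    if t: "t \<in> {a..b}" for t
  proof -
    \<comment> \<open>Separate the state and control directions, on which the two gradients act.\<close>
    have split: "(q1 t - q t, \<epsilon> *\<^sub>R h t, 0) = (q1 t - q t, 0, 0) + \<epsilon> *\<^sub>R (0, h t, 0::real)" by simp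
    have "g t \<bullet> (q1 t - q t) = L' (q t, u t, t) (q1 t - q t, 0, 0) + p t \<bullet> f' (q t, u t, t) (q1 t - q t, 0, 0)"
      by (simp add: g_def inner_commute[of "dH_dx _ _ _ _ _ _"] inner_dH_dx[OF t])
    moreover have "k t = L' (q t, u t, t) (0, h t, 0) + p t \<bullet> f' (q t, u t, t) (0, h t, 0)"
      by (simp add: k_def inner_dH_dv[OF t])
    ultimately show ?thesis
      unfolding R_def u1_def[symmetric] r_def split
      by (simp only: blinfun.add_right blinfun.scaleR_right inner_diff_right inner_add_right inner_scaleR_right)
        (simp add: algebra_simps)
  qed
  then have "integral {a..b} (\<lambda>t. L (q1 t) (u1 t) t - L (q t) (u t) t)
      = integral {a..b} (\<lambda>t. g t \<bullet> frac_int_left a \<alpha> r t - p t \<bullet> r t + \<epsilon> * k t + R t)"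
    by (intro integral_cong) (simp add: \<delta>)
  also have "\<dots> = integral {a..b} (\<lambda>t. g t \<bullet> frac_int_left a \<alpha> r t) - integral {a..b} (\<lambda>t. p t \<bullet> r t)
      + \<epsilon> * integral {a..b} k + integral {a..b} R"
  proof (rule integral_unique, intro has_integral_add has_integral_diff has_integral_mult_right)
    show "((\<lambda>t. g t \<bullet> frac_int_left a \<alpha> r t) has_integral integral {a..b} (\<lambda>t. g t \<bullet> frac_int_left a \<alpha> r t)) {a..b}"
      by (intro integrable_integral integrable_continuous_real continuous_intros g continuous_on_frac_int_left r \<alpha>(1))
    show "((\<lambda>t. p t \<bullet> r t) has_integral integral {a..b} (\<lambda>t. p t \<bullet> r t)) {a..b}"
      by (intro integrable_integral integrable_continuous_real continuous_intros p(1) r)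
    show "(k has_integral integral {a..b} k) {a..b}" "(R has_integral integral {a..b} R) {a..b}"
      by (intro integrable_integral integrable_continuous_real k R)+
  qed
  also have "integral {a..b} (\<lambda>t. g t \<bullet> frac_int_left a \<alpha> r t) = integral {a..b} (\<lambda>t. p t \<bullet> r t)"
  proof -
    have "integral {a..b} (\<lambda>t. g t \<bullet> frac_int_left a \<alpha> r t) = integral {a..b} (\<lambda>t. frac_int_right b \<alpha> g t \<bullet> r t)"
      by (rule frac_int_by_parts[OF \<alpha>(1) r g])
    also have "\<dots> = integral {a..b} (\<lambda>t. p t \<bullet> r t)"
      by (rule integral_cong) (simp add: p(2) g_def[abs_def])
    finally show ?thesis .
  qed
  finally have "integral {a..b} (\<lambda>t. L (q1 t) (u1 t) t - L (q t) (u t) t) = \<epsilon> * integral {a..b} k + integral {a..b} R"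
    by simp
  moreover have "integral {a..b} (\<lambda>t. L (q1 t) (u1 t) t - L (q t) (u t) t)
      = integral {a..b} (\<lambda>t. L (q1 t) (u1 t) t) - integral {a..b} (\<lambda>t. L (q t) (u t) t)"
    by (intro Henstock_Kurzweil_Integration.integral_diff integrable_continuous_real L_along q(1) q1(1) u u1)
  ultimately show "cost a b \<alpha> A L f (\<lambda>t. u t + \<epsilon> *\<^sub>R h t) - cost a b \<alpha> A L f u
      = \<epsilon> * integral {a..b} (\<lambda>t. h t \<bullet> dH_dv L f (q t) (u t) (p t) t) + integral {a..b} R"
    by (simp add: cost_def q1_eq[symmetric] q_def[symmetric] u1_def[symmetric] k_def[abs_def])
qed

text \<open>The remainders are at most \<open>\<eta>\<close> times the size \<open>C \<bar>\<epsilon>\<bar>\<close> of the perturbation, for any \<open>\<eta> > 0\<close>, uniformly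
  in time. The choice of \<open>\<eta>\<close> below makes their integral at most \<open>\<bar>\<epsilon>\<bar> e / 2\<close>.\<close>

lemma cost_derivative:
  assumes u: "continuous_on {a..b} u" and h: "continuous_on {a..b} h"
  defines "q \<equiv> state a b \<alpha> A f u" and "p \<equiv> adjoint_var a b \<alpha> A L f u"
  shows "((\<lambda>\<epsilon>. (cost a b \<alpha> A L f (\<lambda>t. u t + \<epsilon> *\<^sub>R h t) - cost a b \<alpha> A L f u) / \<epsilon>)
    \<longlongrightarrow> integral {a..b} (\<lambda>t. h t \<bullet> dH_dv L f (q t) (u t) (p t) t)) (at 0)"
proof (rule tendstoI)
  fix e :: real assume e: "0 < e"
  define I where "I = integral {a..b} (\<lambda>t. h t \<bullet> dH_dv L f (q t) (u t) (p t) t)"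
  note q = state_props[OF u, folded q_def] and p = adjoint_props[OF u, folded p_def q_def]
  have "bounded (p ` {a..b})"
    by (intro compact_imp_bounded compact_continuous_image p(1)) auto
  then obtain P where P: "0 < P" "\<And>t. t \<in> {a..b} \<Longrightarrow> norm (p t) \<le> P"
    unfolding bounded_pos by blast
  obtain C \<rho> where C: "0 < C" "0 < \<rho>"
    "\<And>\<epsilon> t. \<lbrakk>\<bar>\<epsilon>\<bar> < \<rho>; t \<in> {a..b}\<rbrakk> \<Longrightarrow>
      norm (state a b \<alpha> A f (\<lambda>t. u t + \<epsilon> *\<^sub>R h t) t - q t, \<epsilon> *\<^sub>R h t) \<le> C * \<bar>\<epsilon>\<bar>"
    by (rule state_perturbation[OF u h, folded q_def]) (rule that; blast)
  define \<eta> where "\<eta> = e / (2 * C * (1 + P) * (b - a))"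
  have \<eta>: "0 < \<eta>" unfolding \<eta>_def using e C(1) P(1) ab by simp
  obtain \<rho>f where \<rho>f: "0 < \<rho>f"
    "\<And>t x v. \<lbrakk>t \<in> {a..b}; norm (x, v) < \<rho>f\<rbrakk> \<Longrightarrow>
      norm ((\<lambda>(x, v, t). f x v t) (q t + x, u t + v, t) - (\<lambda>(x, v, t). f x v t) (q t, u t, t) - f' (q t, u t, t) (x, v, 0)) \<le> \<eta> * norm (x, v)"
    using linearize_along[OF f_deriv f'_cont q(1) u \<eta>] by metis
  obtain \<rho>L where \<rho>L: "0 < \<rho>L"
    "\<And>t x v. \<lbrakk>t \<in> {a..b}; norm (x, v) < \<rho>L\<rbrakk> \<Longrightarrow>
      norm ((\<lambda>(x, v, t). L x v t) (q t + x, u t + v, t) - (\<lambda>(x, v, t). L x v t) (q t, u t, t) - L' (q t, u t, t) (x, v, 0)) \<le> \<eta> * norm (x, v)"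
    using linearize_along[OF L_deriv L'_cont q(1) u \<eta>] by metis
  define d where "d = min \<rho> (min (\<rho>f / C) (\<rho>L / C))"
  have "0 < d" using C(1,2) \<rho>f(1) \<rho>L(1) by (simp add: d_def)
  have main: "dist ((cost a b \<alpha> A L f (\<lambda>t. u t + \<epsilon> *\<^sub>R h t) - cost a b \<alpha> A L f u) / \<epsilon>) I < e"
    if \<epsilon>: "\<epsilon> \<noteq> 0" "\<bar>\<epsilon>\<bar> < d" for \<epsilon>
  proof -
    define q1 where "q1 = state a b \<alpha> A f (\<lambda>t. u t + \<epsilon> *\<^sub>R h t)"
    define R where "R = (\<lambda>t. L (q1 t) (u t + \<epsilon> *\<^sub>R h t) t - L (q t) (u t) t - L' (q t, u t, t) (q1 t - q t, \<epsilon> *\<^sub>R h t, 0)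
      + p t \<bullet> (f (q1 t) (u t + \<epsilon> *\<^sub>R h t) t - f (q t) (u t) t - f' (q t, u t, t) (q1 t - q t, \<epsilon> *\<^sub>R h t, 0)))"
    have R: "continuous_on {a..b} R"
      and diff: "cost a b \<alpha> A L f (\<lambda>t. u t + \<epsilon> *\<^sub>R h t) - cost a b \<alpha> A L f u = \<epsilon> * I + integral {a..b} R"
      using cost_difference[OF u h, of \<epsilon>] unfolding R_def q1_def q_def p_def I_def by auto
    have "norm (R t) \<le> \<eta> * (C * \<bar>\<epsilon>\<bar>) * (1 + P)" if t: "t \<in> {a..b}" for t
    proof -
      define N where "N = norm (q1 t - q t, \<epsilon> *\<^sub>R h t)"
      have N: "N \<le> C * \<bar>\<epsilon>\<bar>"
        using C(3)[of \<epsilon> t] \<epsilon> t by (simp add: N_def q1_def d_def)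
      have "C * \<bar>\<epsilon>\<bar> < \<rho>f" "C * \<bar>\<epsilon>\<bar> < \<rho>L"
        using \<epsilon>(2) C(1) by (simp_all add: d_def field_simps)
      then have small: "norm (q1 t - q t, \<epsilon> *\<^sub>R h t) < \<rho>f" "norm (q1 t - q t, \<epsilon> *\<^sub>R h t) < \<rho>L"
        using N by (simp_all add: N_def)
      define X where "X = f (q1 t) (u t + \<epsilon> *\<^sub>R h t) t - f (q t) (u t) t - f' (q t, u t, t) (q1 t - q t, \<epsilon> *\<^sub>R h t, 0)"
      define Y where "Y = L (q1 t) (u t + \<epsilon> *\<^sub>R h t) t - L (q t) (u t) t - L' (q t, u t, t) (q1 t - q t, \<epsilon> *\<^sub>R h t, 0)"
      have le: "\<eta> * N \<le> \<eta> * (C * \<bar>\<epsilon>\<bar>)" using N \<eta> by simp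
      have X: "norm X \<le> \<eta> * (C * \<bar>\<epsilon>\<bar>)"
        using order_trans[OF \<rho>f(2)[OF t small(1)] le[unfolded N_def]] by (simp add: X_def)
      have Y: "norm Y \<le> \<eta> * (C * \<bar>\<epsilon>\<bar>)"
        using order_trans[OF \<rho>L(2)[OF t small(2)] le[unfolded N_def]] by (simp add: Y_def)
      have "norm (R t) \<le> norm Y + norm (p t \<bullet> X)"
        unfolding R_def X_def[symmetric] Y_def[symmetric] by (rule norm_triangle_ineq)
      also have "norm (p t \<bullet> X) \<le> norm (p t) * norm X"
        using Cauchy_Schwarz_ineq2 by simp
      also have "\<dots> \<le> P * (\<eta> * (C * \<bar>\<epsilon>\<bar>))"
        using P(2)[OF t] X P(1) by (intro mult_mono) auto
      finally show ?thesis using Y by (simp add: algebra_simps)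
    qed
    then have "norm (integral {a..b} R) \<le> \<eta> * (C * \<bar>\<epsilon>\<bar>) * (1 + P) * (b - a)"
      by (intro integral_bound R less_imp_le[OF ab])
    also have "\<dots> = e / 2 * \<bar>\<epsilon>\<bar>"
    proof -
      have "2 * C * (1 + P) * (b - a) \<noteq> 0" using C(1) P(1) ab by simp
      then have "\<eta> * (2 * C * (1 + P) * (b - a)) = e"
        by (rule nonzero_eq_divide_eq[THEN iffD1, OF _ \<eta>_def])
      then have "e / 2 * \<bar>\<epsilon>\<bar> = \<eta> * (2 * C * (1 + P) * (b - a)) / 2 * \<bar>\<epsilon>\<bar>" by (simp only:)
      also have "\<dots> = \<eta> * (C * \<bar>\<epsilon>\<bar>) * (1 + P) * (b - a)" by simp
      finally show ?thesis by (rule sym)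
    qed
    also have "\<dots> < e * \<bar>\<epsilon>\<bar>" using e \<epsilon>(1) by simp
    finally have "\<bar>integral {a..b} R\<bar> / \<bar>\<epsilon>\<bar> < e" using \<epsilon>(1) by (simp add: pos_divide_less_eq)
    moreover have "(cost a b \<alpha> A L f (\<lambda>t. u t + \<epsilon> *\<^sub>R h t) - cost a b \<alpha> A L f u) / \<epsilon> - I = integral {a..b} R / \<epsilon>"
      using \<epsilon>(1) by (simp add: diff field_simps)
    ultimately show ?thesis
      by (simp only: dist_norm real_norm_def abs_divide)
  qed
  show "\<forall>\<^sub>F \<epsilon> in at 0. dist ((cost a b \<alpha> A L f (\<lambda>t. u t + \<epsilon> *\<^sub>R h t) - cost a b \<alpha> A L f u) / \<epsilon>)
      (integral {a..b} (\<lambda>t. h t \<bullet> dH_dv L f (q t) (u t) (p t) t)) < e"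
    unfolding eventually_at I_def[symmetric]
    by (rule exI[of _ d]) (use \<open>0 < d\<close> main in auto)
qed

lemma critical_point_iff:
  "critical_point a b \<alpha> A L f u \<longleftrightarrow> continuous_on {a..b} u \<and>
    (\<forall>t\<in>{a..b}. dH_dv L f (state a b \<alpha> A f u t) (u t) (adjoint_var a b \<alpha> A L f u t) t = 0)"
proof (cases "continuous_on {a..b} u")
  case u: True
  define k where "k t = dH_dv L f (state a b \<alpha> A f u t) (u t) (adjoint_var a b \<alpha> A L f u t) t" for t
  have k: "continuous_on {a..b} k"
    unfolding k_def[abs_def]
    by (rule continuous_dH_dv[OF state_props(1)[OF u] u adjoint_props(1)[OF u] continuous_on_id])
  have deriv: "((\<lambda>\<epsilon>. (cost a b \<alpha> A L f (\<lambda>t. u t + \<epsilon> *\<^sub>R h t) - cost a b \<alpha> A L f u) / \<epsilon>)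
      \<longlongrightarrow> integral {a..b} (\<lambda>t. h t \<bullet> k t)) (at 0)" if "continuous_on {a..b} h" for h
    unfolding k_def by (rule cost_derivative[OF u that])
  show ?thesis
  proof
    \<comment> \<open>Test with the gradient itself: a continuous function whose square integrates to zero vanishes.\<close>
    assume "critical_point a b \<alpha> A L f u"
    then have "((\<lambda>\<epsilon>. (cost a b \<alpha> A L f (\<lambda>t. u t + \<epsilon> *\<^sub>R k t) - cost a b \<alpha> A L f u) / \<epsilon>) \<longlongrightarrow> 0) (at 0)"
      using k by (simp add: critical_point_def)
    then have "integral {a..b} (\<lambda>t. k t \<bullet> k t) = 0"
      using tendsto_unique[OF _ deriv[OF k]] by simp
    moreover have "(\<lambda>t. k t \<bullet> k t) integrable_on {a..b}"
      by (intro integrable_continuous_real continuous_intros k)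
    ultimately have "((\<lambda>t. k t \<bullet> k t) has_integral 0) (cbox a b)"
      using integrable_integral by fastforce
    moreover have "continuous_on (cbox a b) (\<lambda>t. k t \<bullet> k t)"
      by (simp, intro continuous_intros k)
    ultimately have "k t \<bullet> k t = 0" if "t \<in> {a..b}" for t
      using has_integral_0_cbox_imp_0[of a b "\<lambda>t. k t \<bullet> k t" t] that ab by simp
    then show "continuous_on {a..b} u \<and> (\<forall>t\<in>{a..b}. dH_dv L f (state a b \<alpha> A f u t) (u t) (adjoint_var a b \<alpha> A L f u t) t = 0)"
      using u by (simp add: k_def)
  next
    assume "continuous_on {a..b} u \<and> (\<forall>t\<in>{a..b}. dH_dv L f (state a b \<alpha> A f u t) (u t) (adjoint_var a b \<alpha> A L f u t) t = 0)"
    then have "integral {a..b} (\<lambda>t. h t \<bullet> k t) = integral {a..b} (\<lambda>t. 0)" for h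
      by (intro integral_cong) (simp add: k_def)
    then show "critical_point a b \<alpha> A L f u"
      using u deriv by (simp add: critical_point_def)
  qed
qed (simp add: critical_point_def)

text \<open>Since \<open>\<partial>H/\<partial>w = f\<close>, the first equation does not involve \<open>p\<close> and makes \<open>q\<close> the state of \<open>u\<close>; therefore the adjoint
  equation along \<open>q\<close> is the one along the state.\<close>

lemma pontryagin_solution_iff:
  "pontryagin_solution a b \<alpha> A L f q u p \<longleftrightarrow> continuous_on {a..b} u \<and>
     is_state a b \<alpha> A f u q \<and> is_adjoint a b \<alpha> A L f u p \<and>
     (\<forall>t\<in>{a..b}. dH_dv L f (q t) (u t) (p t) t = 0)"
proof -
  have "(\<forall>t\<in>{a..<b}. has_RL_deriv_right a b \<alpha> p t (dH_dx L f (q t) (u t) (p t) t)) \<longleftrightarrow>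
      (\<forall>t\<in>{a..<b}. has_Caputo_deriv_right a b \<alpha> p t (dH_dx L f (state a b \<alpha> A f u t) (u t) (p t) t))"
    if "continuous_on {a..b} u" "is_state a b \<alpha> A f u q" "p b = 0"
    using state_unique[OF that(1,2) is_state_state[OF that(1)]] that(3)
    by (simp add: has_Caputo_deriv_right_def)
  then show ?thesis
    by (auto simp: pontryagin_solution_def is_adjoint_def is_state_def dH_dw_eq)
qed

end

theorem corollary7:
  fixes a b \<alpha> :: real and A :: "real^'d"
    and f :: "real^'d \<Rightarrow> real^'m \<Rightarrow> real \<Rightarrow> real^'d"
    and L :: "real^'d \<Rightarrow> real^'m \<Rightarrow> real \<Rightarrow> real"
  assumes "a < b" and "0 < \<alpha>" and "\<alpha> \<le> 1"
    and f_C2: "C2_on (UNIV \<times> UNIV \<times> {a..b}) (\<lambda>(x, v, t). f x v t)"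
    and f_Lipschitz: "\<exists>M\<ge>0. \<forall>x1 x2 v. \<forall>t\<in>{a..b}.
           norm (f x1 v t - f x2 v t) \<le> M * norm (x1 - x2)"
    and L_C2: "C2_on (UNIV \<times> UNIV \<times> {a..b}) (\<lambda>(x, v, t). L x v t)"
  shows "((\<exists>u. critical_point a b \<alpha> A L f u) \<longleftrightarrow>
            (\<exists>q u p. pontryagin_solution a b \<alpha> A L f q u p)) \<and>
         (\<forall>q u p. pontryagin_solution a b \<alpha> A L f q u p \<longrightarrow>
            critical_point a b \<alpha> A L f u \<and>
            (\<forall>t\<in>{a..b}. q t = state a b \<alpha> A f u t \<and> p t = adjoint_var a b \<alpha> A L f u t))"
proof -
  obtain f' where f': "\<And>z. z \<in> UNIV \<times> UNIV \<times> {a..b} \<Longrightarrow>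
      ((\<lambda>(x, v, t). f x v t) has_derivative blinfun_apply (f' z)) (at z within UNIV \<times> UNIV \<times> {a..b})"
    "continuous_on (UNIV \<times> UNIV \<times> {a..b}) f'"
    using C2_on_imp_C1[OF f_C2] by metis
  obtain L' where L': "\<And>z. z \<in> UNIV \<times> UNIV \<times> {a..b} \<Longrightarrow>
      ((\<lambda>(x, v, t). L x v t) has_derivative blinfun_apply (L' z)) (at z within UNIV \<times> UNIV \<times> {a..b})"
    "continuous_on (UNIV \<times> UNIV \<times> {a..b}) L'"
    using C2_on_imp_C1[OF L_C2] by metis
  obtain M where M: "0 \<le> M"
    "\<And>x1 x2 v t. t \<in> {a..b} \<Longrightarrow> norm (f x1 v t - f x2 v t) \<le> M * norm (x1 - x2)"
    using f_Lipschitz by blast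
  interpret control_problem a b \<alpha> M A f L f' L'
    by unfold_locales (use assms(1-3) f' L' M in auto)
  have sol: "critical_point a b \<alpha> A L f u \<and>
      (\<forall>t\<in>{a..b}. q t = state a b \<alpha> A f u t \<and> p t = adjoint_var a b \<alpha> A L f u t)"
    if "pontryagin_solution a b \<alpha> A L f q u p" for q u p
  proof -
    have u: "continuous_on {a..b} u" and q: "is_state a b \<alpha> A f u q" and p: "is_adjoint a b \<alpha> A L f u p"
      and v: "\<forall>t\<in>{a..b}. dH_dv L f (q t) (u t) (p t) t = 0"
      using that by (auto simp: pontryagin_solution_iff)
    have "\<forall>t\<in>{a..b}. q t = state a b \<alpha> A f u t \<and> p t = adjoint_var a b \<alpha> A L f u t"
      using state_unique[OF u q is_state_state[OF u]] adjoint_unique[OF u p is_adjoint_adjoint_var[OF u]] by blast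
    then show ?thesis using u v by (simp add: critical_point_iff)
  qed
  moreover have "pontryagin_solution a b \<alpha> A L f (state a b \<alpha> A f u) u (adjoint_var a b \<alpha> A L f u)"
    if "critical_point a b \<alpha> A L f u" for u
    using that is_state_state is_adjoint_adjoint_var by (simp add: critical_point_iff pontryagin_solution_iff)
  ultimately show ?thesis by blast
qed

end
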